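(* Let $H$ be a $(2,1)$-inseparable graph. Then there is a constant $C=C(H)$ such that for every $n\in\mathbb{N}$ there exists an $H$-percolating graph $\tilde G$ with $v(\tilde G)\le Cn$ and $\tau_H(\tilde G)\ge M_H(n)$.
   Context: For graphs $H$ and $G$, the $H$-process on $G$ is the sequence $(G_i)_{i\ge0}$ with $G_0=G$, $V(G_i)=V(G)$, and $E(G_i)=E(G_{i-1})\cup\{e\in\binom{V(G)}{2}: n_H(G_{i-1}+e)>n_H(G_{i-1})\}$, where $n_H(F)$ is the number of copies of $H$ in $F$ (i.e. an edge is added if it is the last missing edge of some copy of $H$). For finite $G$ the running time is $\tau_H(G)=\min\{t\in\mathbb{N}: G_t=G_{t+1}\}$, and the final graph is $G_{\tau_H(G)}$. $G$ is $H$-percolating if its final graph is the complete graph on $V(G)$. $M_H(n)=\max\{\tau_H(G): G \text{ an } n\text{-vertex graph}\}$. A graph $H$ with an edge is $(2,1)$-separable if it can be disconnected by deleting at most two vertices (with incident edges) and one further edge; otherwise it is $(2,1)$-inseparable. *)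

theory Defs
  imports Complex_Main "HOL-Library.Ramsey"
begin

datatype 'a graph = Graph (verts: "'a set") (edges: "'a set set")

definition fin_graph :: "'a graph \<Rightarrow> bool" where
  "fin_graph G \<longleftrightarrow> finite (verts G) \<and> edges G \<subseteq> [verts G]\<^bsup>2\<^esup>"

definition complete_graph :: "'a set \<Rightarrow> 'a graph" where
  "complete_graph V = Graph V ([V]\<^bsup>2\<^esup>)"

definition add_edge :: "'a graph \<Rightarrow> 'a set \<Rightarrow> 'a graph" where
  "add_edge G e = Graph (verts G) (insert e (edges G))"

definition del_edge :: "'a graph \<Rightarrow> 'a set \<Rightarrow> 'a graph" where
  "del_edge G e = Graph (verts G) (edges G - {e})"

definition del_verts :: "'a graph \<Rightarrow> 'a set \<Rightarrow> 'a graph" where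
  "del_verts G S = Graph (verts G - S) {e \<in> edges G. e \<inter> S = {}}"

definition subgraph :: "'a graph \<Rightarrow> 'a graph \<Rightarrow> bool" where
  "subgraph F G \<longleftrightarrow> fin_graph F \<and> verts F \<subseteq> verts G \<and> edges F \<subseteq> edges G"

definition graph_iso :: "'a graph \<Rightarrow> 'b graph \<Rightarrow> bool" where
  "graph_iso G F \<longleftrightarrow> (\<exists>f. bij_betw f (verts G) (verts F) \<and> edges F = (\<lambda>e. f ` e) ` edges G)"

definition connected_graph :: "'a graph \<Rightarrow> bool" where
  "connected_graph G \<longleftrightarrow>
     (\<forall>u \<in> verts G. \<forall>v \<in> verts G. (u, v) \<in> {(x, y). {x, y} \<in> edges G}\<^sup>*)"

text \<open>Copies are unlabelled: they are counted as subgraphs, not as embeddings.\<close>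

definition copies :: "'a graph \<Rightarrow> 'b graph \<Rightarrow> 'b graph set" where
  "copies H F = {H'. subgraph H' F \<and> graph_iso H H'}"

definition num_copies :: "'a graph \<Rightarrow> 'b graph \<Rightarrow> nat" where
  "num_copies H F = card (copies H F)"

text \<open>As the number of copies is a natural number, the process and everything derived from it
  is meaningful for finite host graphs only.\<close>

definition process_step :: "'a graph \<Rightarrow> 'b graph \<Rightarrow> 'b graph" where
  "process_step H G = Graph (verts G)
     (edges G \<union> {e \<in> [verts G]\<^bsup>2\<^esup>. num_copies H (add_edge G e) > num_copies H G})"

primrec H_process :: "'a graph \<Rightarrow> 'b graph \<Rightarrow> nat \<Rightarrow> 'b graph" where
  "H_process H G 0 = G"
| "H_process H G (Suc i) = process_step H (H_process H G i)"

definition running_time :: "'a graph \<Rightarrow> 'b graph \<Rightarrow> nat" where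
  "running_time H G = (LEAST t. H_process H G t = H_process H G (Suc t))"

definition final_graph :: "'a graph \<Rightarrow> 'b graph \<Rightarrow> 'b graph" where
  "final_graph H G = H_process H G (running_time H G)"

definition percolating :: "'a graph \<Rightarrow> 'b graph \<Rightarrow> bool" where
  "percolating H G \<longleftrightarrow> final_graph H G = complete_graph (verts G)"

text \<open>Every finite graph is isomorphic to one with vertices in \<^typ>\<open>nat\<close>.\<close>

definition max_running_time :: "'a graph \<Rightarrow> nat \<Rightarrow> nat" where
  "max_running_time H n =
     Max {running_time H G | G :: nat graph. fin_graph G \<and> card (verts G) = n}"

definition separable_2_1 :: "'a graph \<Rightarrow> bool" where
  "separable_2_1 H \<longleftrightarrow> edges H \<noteq> {} \<and>
     (\<exists>S \<subseteq> verts H. card S \<le> 2 \<and>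
        (\<exists>e \<in> edges (del_verts H S). \<not> connected_graph (del_edge (del_verts H S) e)))"

definition inseparable_2_1 :: "'a graph \<Rightarrow> bool" where
  "inseparable_2_1 H \<longleftrightarrow> edges H \<noteq> {} \<and> \<not> separable_2_1 H"

text \<open>The minimum in \<^const>\<open>running_time\<close> and the maximum in \<^const>\<open>max_running_time\<close> are attained.\<close>

lemma verts_process [simp]: "verts (H_process H G i) = verts G"
  by (induction i) (auto simp: process_step_def)

lemma fin_graph_process: "fin_graph G \<Longrightarrow> fin_graph (H_process H G i)"
  by (induction i) (auto simp: process_step_def fin_graph_def)

lemma card_edges_process:
  assumes "fin_graph G" "\<And>s. s < t \<Longrightarrow> H_process H G s \<noteq> H_process H G (Suc s)"
  shows "t \<le> card (edges (H_process H G t))"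
  using assms(2)
proof (induction t)
  case 0
  show ?case by simp
next
  case (Suc t)
  let ?A = "H_process H G t" and ?B = "H_process H G (Suc t)"
  have "?A \<noteq> ?B" using Suc.prems by blast
  then have ne: "edges ?A \<noteq> edges ?B"
    by (metis graph.expand verts_process)
  have "edges ?A \<subseteq> edges ?B" by (auto simp: process_step_def)
  moreover have "finite (edges ?B)"
    using fin_graph_process[OF assms(1), of H "Suc t"]
    unfolding fin_graph_def by (meson finite_imp_finite_nsets finite_subset)
  ultimately have "card (edges ?A) < card (edges ?B)"
    using ne by (intro psubset_card_mono) auto
  moreover have "t \<le> card (edges ?A)" using Suc by auto
  ultimately show ?case by linarith
qed

lemma process_stable_bound:
  assumes "fin_graph G"
  shows "\<exists>t \<le> card (verts G) choose 2. H_process H G t = H_process H G (Suc t)"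
proof (rule ccontr)
  let ?m = "card (verts G) choose 2"
  assume "\<not> ?thesis"
  then have "Suc ?m \<le> card (edges (H_process H G (Suc ?m)))"
    by (intro card_edges_process[OF assms]) auto
  also have "\<dots> \<le> card ([verts G]\<^bsup>2\<^esup>)"
    using fin_graph_process[OF assms, of H "Suc ?m"]
    unfolding fin_graph_def verts_process by (intro card_mono finite_imp_finite_nsets) auto
  also have "\<dots> = ?m"
    using assms by (simp add: card_nsets fin_graph_def)
  finally show False by simp
qed

lemma running_time_stable:
  "fin_graph G \<Longrightarrow>
    H_process H G (running_time H G) = H_process H G (Suc (running_time H G))"
  unfolding running_time_def by (rule LeastI_ex) (use process_stable_bound in blast)

lemma running_time_le: "fin_graph G \<Longrightarrow> running_time H G \<le> card (verts G) choose 2"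
  unfolding running_time_def by (meson process_stable_bound Least_le order_trans)

lemma finite_running_times:
  "finite {running_time H G | G :: nat graph. fin_graph G \<and> card (verts G) = n}"
  by (rule finite_subset[of _ "{..n choose 2}"]) (auto simp: running_time_le)

lemma running_times_nonempty:
  "{running_time H G | G :: nat graph. fin_graph G \<and> card (verts G) = n} \<noteq> {}"
proof -
  have "fin_graph (Graph {..<n} {})" "card (verts (Graph {..<n} {})) = n"
    by (auto simp: fin_graph_def)
  then show ?thesis by blast
qed

end

theory Submission
  imports Defs
begin

text \<open>
  Let \<open>H\<close> have \<open>k\<close> vertices and \<open>h\<close> edges. Inseparability says that \<open>H\<close> minus an edge is 3-connected, so
  a copy of it cannot cross a cut of at most two vertices. Let \<open>G\<close> on the vertex set \<open>W\<close> have maximum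
  running time and let \<open>ab\<close> be an edge added in its last step. We attach to \<open>G\<close> a graph \<open>E\<close> without
  edges inside \<open>W\<close> that does not interact with the process on \<open>G\<close> before \<open>ab\<close> appears, and such that
  \<open>E + ab\<close> percolates.

  The attachment consists of copies of \<open>H - e - f\<close> (with \<open>e\<close>, \<open>f\<close> disjoint edges), in which the
  appearance of \<open>e\<close> forces \<open>f\<close>. Such blocks are glued along pairs of nonadjacent vertices: first
  a long chain starting at \<open>ab\<close>, then, from each link of it, a side chain of more than \<open>k\<close> blocks that
  ends in a prescribed pair of a set \<open>Y\<close>. The prescribed pairs \<open>y\<^sub>i y\<^sub>j\<close> with \<open>\<bar>i - j\<bar> \<le> k\<close> suffice to make \<open>Y\<close>
  a clique. Finally every vertex outside \<open>Y\<close> is joined greedily to \<open>k - 2\<close> vertices of \<open>Y\<close>, each at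
  distance at least \<open>k\<close> from it at that moment; once \<open>Y\<close> is a clique these edges absorb the vertex.
  All degrees outside \<open>W\<close> are bounded, so balls of radius \<open>k\<close> have size \<open>O(\<bar>W\<bar>)\<close> and it is enough to take
  \<open>Y\<close> of size \<open>O(\<bar>W\<bar>)\<close>. Gluing along two pairs, or adding an edge, at distance at least \<open>k\<close>
  creates no new 3-connected subgraph on \<open>k\<close> vertices.
\<close>

section \<open>Connectivity, degrees and the percolation process\<close>

definition connected_on :: "'v set set \<Rightarrow> 'v set \<Rightarrow> bool" where
  "connected_on K Z \<longleftrightarrow> (\<forall>Y \<subseteq> Z. Y \<noteq> {} \<longrightarrow> Y \<noteq> Z \<longrightarrow> (\<exists>u \<in> Y. \<exists>v \<in> Z - Y. {u, v} \<in> K))"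

definition three_connected_on :: "'v set set \<Rightarrow> 'v set \<Rightarrow> bool" where
  "three_connected_on K X \<longleftrightarrow> (\<forall>S \<subseteq> X. card S \<le> 2 \<longrightarrow> connected_on K (X - S))"

definition degree :: "'v set set \<Rightarrow> 'v \<Rightarrow> nat" where
  "degree E v = card {d \<in> E. v \<in> d}"

lemma connected_onE:
  assumes "connected_on K Z" "Y \<subseteq> Z" "Y \<noteq> {}" "Y \<noteq> Z"
  obtains u v where "u \<in> Y" "v \<in> Z" "v \<notin> Y" "{u, v} \<in> K"
  using assms unfolding connected_on_def by (meson DiffE)

lemma connected_on_mono: "connected_on K Z \<Longrightarrow> K \<subseteq> K' \<Longrightarrow> connected_on K' Z"
  unfolding connected_on_def by (meson subsetD)

lemma three_connected_onD:
  assumes "three_connected_on K X" "finite S" "card S \<le> 2" "Y \<subseteq> X - S" "Y \<noteq> {}" "Y \<noteq> X - S"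
  obtains u v where "u \<in> Y" "v \<in> X" "v \<notin> S" "v \<notin> Y" "{u, v} \<in> K"
proof -
  have "card (S \<inter> X) \<le> 2"
    by (meson Int_lower1 assms(2,3) card_mono le_trans)
  then have "connected_on K (X - S \<inter> X)"
    using assms(1) unfolding three_connected_on_def by simp
  moreover have "X - S \<inter> X = X - S" by blast
  ultimately have "connected_on K (X - S)" by simp
  from connected_onE[OF this assms(4-6)] that show ?thesis by (metis DiffE)
qed

lemma three_connected_on_mono:
  assumes "three_connected_on K X" "\<And>u v. u \<in> X \<Longrightarrow> v \<in> X \<Longrightarrow> {u, v} \<in> K \<Longrightarrow> {u, v} \<in> K'"
  shows "three_connected_on K' X"
  unfolding three_connected_on_def connected_on_def
proof (intro allI impI)
  fix S Y assume *: "S \<subseteq> X" "card S \<le> 2" "Y \<subseteq> X - S" "Y \<noteq> {}" "Y \<noteq> X - S"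
  have "connected_on K (X - S)" using assms(1) *(1,2) unfolding three_connected_on_def by simp
  from connected_onE[OF this *(3-5)]
  obtain u v where uv: "u \<in> Y" "v \<in> X - S" "v \<notin> Y" "{u, v} \<in> K" .
  have "{u, v} \<in> K'" by (rule assms(2)) (use uv *(3) in auto)
  then show "\<exists>u\<in>Y. \<exists>v\<in>X - S - Y. {u, v} \<in> K'" using uv by auto
qed

lemma edges_nsetsD: "E \<subseteq> [V]\<^bsup>2\<^esup> \<Longrightarrow> {u, v} \<in> E \<Longrightarrow> u \<in> V \<and> v \<in> V \<and> u \<noteq> v"
  by (metis doubleton_in_nsets_2 subsetD)

lemma nsets2_memE:
  assumes "d \<in> E" "E \<subseteq> [V]\<^bsup>2\<^esup>"
  obtains u v where "d = {u, v}" "u \<in> V" "v \<in> V" "u \<noteq> v"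
  using assms nsets2_E[of d V] by blast

lemma connected_graph_imp_connected_on:
  assumes "connected_graph G" "edges G \<subseteq> [verts G]\<^bsup>2\<^esup>"
  shows "connected_on (edges G) (verts G)"
  unfolding connected_on_def
proof (intro allI impI, rule ccontr)
  fix Y assume Y: "Y \<subseteq> verts G" "Y \<noteq> {}" "Y \<noteq> verts G"
    and no: "\<not> (\<exists>u\<in>Y. \<exists>v\<in>verts G - Y. {u, v} \<in> edges G)"
  obtain y z where yz: "y \<in> Y" "z \<in> verts G - Y" using Y by blast
  let ?R = "{(x, y). {x, y} \<in> edges G}"
  have "(y, z) \<in> ?R\<^sup>*" using assms yz Y unfolding connected_graph_def by blast
  moreover have "v \<in> Y" if "(y, v) \<in> ?R\<^sup>*" for v
    using that
  proof induction
    case base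
    show ?case using yz by simp
  next
    case (step u v)
    then have "{u, v} \<in> edges G" by simp
    moreover from this have "v \<in> verts G" using edges_nsetsD[OF assms(2)] by auto
    ultimately show ?case using no step.IH by auto
  qed
  ultimately show False using yz by blast
qed

definition completes :: "'a graph \<Rightarrow> 'b set set \<Rightarrow> 'b set \<Rightarrow> ('a \<Rightarrow> 'b) \<Rightarrow> 'a set \<Rightarrow> bool" where
  "completes H Z e f h \<longleftrightarrow> inj_on f (verts H) \<and> h \<in> edges H \<and> f ` h = e \<and>
     (\<forall>d \<in> edges H - {h}. f ` d \<in> Z)"

lemma finite_copies:
  assumes "finite (verts F)" "finite (edges F)"
  shows "finite (copies H F)"
proof (rule finite_subset)
  show "copies H F \<subseteq> (\<lambda>(A, B). Graph A B) ` (Pow (verts F) \<times> Pow (edges F))"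
  proof
    fix x assume "x \<in> copies H F"
    then have "verts x \<subseteq> verts F" "edges x \<subseteq> edges F" by (auto simp: copies_def subgraph_def)
    then show "x \<in> (\<lambda>(A, B). Graph A B) ` (Pow (verts F) \<times> Pow (edges F))"
      by (intro image_eqI[of _ _ "(verts x, edges x)"]) auto
  qed
qed (use assms in auto)

lemma process_step_iff:
  assumes H: "fin_graph H" and G: "fin_graph G"
  shows "e \<in> edges (process_step H G) \<longleftrightarrow> e \<in> edges G \<or>
    e \<in> [verts G]\<^bsup>2\<^esup> \<and> (\<exists>f h. f ` verts H \<subseteq> verts G \<and> completes H (edges G) e f h)"
    (is "_ \<longleftrightarrow> _ \<or> _ \<and> ?C")
proof (cases "e \<in> edges G \<or> e \<notin> [verts G]\<^bsup>2\<^esup>")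
  case True
  then show ?thesis by (auto simp: process_step_def)
next
  case False
  then have e: "e \<notin> edges G" "e \<in> [verts G]\<^bsup>2\<^esup>" by auto
  have fin: "finite (verts G)" "finite (edges G)"
    using G unfolding fin_graph_def by (auto intro: finite_subset finite_imp_finite_nsets)
  let ?A = "copies H (add_edge G e)" and ?B = "copies H G"
  have finA: "finite ?A" and finB: "finite ?B" using fin
    by (auto intro!: finite_copies simp: add_edge_def)
  have BA: "?B \<subseteq> ?A" by (auto simp: copies_def subgraph_def add_edge_def)
  have "num_copies H (add_edge G e) > num_copies H G \<longleftrightarrow> ?C"
  proof
    assume "num_copies H (add_edge G e) > num_copies H G"
    then have "\<not> ?A \<subseteq> ?B" unfolding num_copies_def using finB card_mono by (metis leD)
    then obtain H' where H': "H' \<in> ?A" "H' \<notin> ?B" by blast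
    then have sub: "fin_graph H'" "verts H' \<subseteq> verts G" "edges H' \<subseteq> insert e (edges G)"
      "graph_iso H H'" by (auto simp: copies_def subgraph_def add_edge_def)
    then have "e \<in> edges H'" using H'(2) unfolding copies_def subgraph_def by blast
    moreover obtain f where f: "bij_betw f (verts H) (verts H')" "edges H' = (\<lambda>e. f ` e) ` edges H"
      using sub(4) unfolding graph_iso_def by blast
    ultimately obtain h where h: "h \<in> edges H" "e = f ` h" by blast
    have inj: "inj_on f (verts H)" using f(1) by (simp add: bij_betw_def)
    have "f ` d \<in> edges G" if d: "d \<in> edges H - {h}" for d
    proof -
      have "d \<subseteq> verts H" "h \<subseteq> verts H" using H d h unfolding fin_graph_def nsets_def by auto
      then have "f ` d \<noteq> f ` h" using inj d by (metis Diff_iff inj_on_image_eq_iff singletonI)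
      moreover have "f ` d \<in> edges H'" using f(2) d by blast
      ultimately show ?thesis using sub(3) h(2) by blast
    qed
    moreover have "f ` verts H \<subseteq> verts G" using f(1) sub(2) by (simp add: bij_betw_def)
    ultimately show ?C unfolding completes_def using inj h by blast
  next
    assume ?C
    then obtain f h where f: "inj_on f (verts H)" "f ` verts H \<subseteq> verts G" "h \<in> edges H" "f ` h = e"
      "\<forall>d \<in> edges H - {h}. f ` d \<in> edges G" unfolding completes_def by blast
    define H' where "H' = Graph (f ` verts H) ((\<lambda>d. f ` d) ` edges H)"
    have "(\<lambda>d. f ` d) ` edges H \<subseteq> [f ` verts H]\<^bsup>2\<^esup>"
    proof (clarify)
      fix d assume "d \<in> edges H"
      then have "d \<subseteq> verts H" "finite d" "card d = 2" using H unfolding fin_graph_def nsets_def by auto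
      then show "f ` d \<in> [f ` verts H]\<^bsup>2\<^esup>" unfolding nsets_def
        using card_image[OF inj_on_subset[OF f(1)]] by auto
    qed
    then have "fin_graph H'" using H unfolding fin_graph_def H'_def by simp
    moreover have "graph_iso H H'" unfolding graph_iso_def H'_def
      using f(1) by (auto intro!: exI[of _ f] simp: bij_betw_def)
    moreover have "edges H' \<subseteq> insert e (edges G)" unfolding H'_def using f(4,5) by auto
    ultimately have "H' \<in> ?A" using f(2)
      unfolding copies_def subgraph_def add_edge_def H'_def by auto
    moreover have "H' \<notin> ?B"
      using e(1) f(3,4) unfolding copies_def subgraph_def H'_def by auto
    ultimately show "num_copies H (add_edge G e) > num_copies H G" unfolding num_copies_def
      using BA finA by (metis psubsetI psubset_card_mono)
  qed
  then show ?thesis using e by (auto simp: process_step_def)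
qed

lemma process_constant_from:
  assumes "H_process H G t = H_process H G (Suc t)"
  shows "H_process H G (t + m) = H_process H G t"
proof (induction m)
  case 0
  show ?case by simp
next
  case (Suc m)
  have "H_process H G (t + Suc m) = process_step H (H_process H G (t + m))" by simp
  also have "\<dots> = H_process H G (Suc t)" unfolding Suc.IH by simp
  also have "\<dots> = H_process H G t" using assms by (rule sym)
  finally show ?case .
qed

lemma running_time_ge:
  assumes "fin_graph G" "H_process H G t \<noteq> H_process H G (Suc t)"
  shows "Suc t \<le> running_time H G"
proof (rule ccontr)
  assume "\<not> ?thesis"
  then obtain m where m: "t = running_time H G + m"
    by (metis not_less_eq_eq le_iff_add)
  have "H_process H G (running_time H G + n) = H_process H G (running_time H G)" for n
    using running_time_stable[OF assms(1)] by (rule process_constant_from)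
  from this[of m] this[of "Suc m"] show False
    using assms(2) unfolding m add_Suc_right by argo
qed

lemma running_time_not_stable:
  assumes "t < running_time H G"
  shows "H_process H G t \<noteq> H_process H G (Suc t)"
  using assms unfolding running_time_def by (rule not_less_Least)

lemma process_edges_mono: "edges (H_process H G t) \<subseteq> edges (H_process H G (t + m))"
  by (induction m) (auto simp: process_step_def)

definition percolation_closed :: "'a graph \<Rightarrow> 'b set set \<Rightarrow> bool" where
  "percolation_closed H Z \<longleftrightarrow> (\<forall>e f h. completes H Z e f h \<longrightarrow> e \<in> Z)"

lemma fresh_injection:
  assumes "finite A" "finite (V :: nat set)"
  obtains g where "inj_on g A" "g ` A \<inter> V = {}"
proof -
  have "infinite (- V)" using assms(2) by (simp add: finite_compl)
  then obtain T where T: "finite T" "card T = card A" "T \<subseteq> - V"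
    using infinite_arbitrarily_large by blast
  then obtain g where "bij_betw g A T" using finite_same_card_bij assms(1) by metis
  then show ?thesis using that[of g] T by (auto simp: bij_betw_def)
qed

lemma nsets2_subset_pair: "d \<in> [V]\<^bsup>2\<^esup> \<Longrightarrow> d \<subseteq> {u, v} \<Longrightarrow> d = {u, v}"
  by (auto simp: nsets_def card_2_iff)

lemma degree_Un_le:
  assumes "finite E" "finite B"
  shows "degree (E \<union> B) v \<le> degree E v + degree B v"
proof -
  have "{d \<in> E \<union> B. v \<in> d} = {d \<in> E. v \<in> d} \<union> {d \<in> B. v \<in> d}" by auto
  then show ?thesis unfolding degree_def by (simp add: card_Un_le)
qed

lemma degree_le_card: "finite B \<Longrightarrow> degree B v \<le> card B"
  unfolding degree_def by (intro card_mono) auto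

lemma degree_eq_0: "E \<subseteq> [V]\<^bsup>2\<^esup> \<Longrightarrow> v \<notin> V \<Longrightarrow> degree E v = 0"
  unfolding degree_def nsets_def by (metis (no_types, lifting) card.empty empty_Collect_eq mem_Collect_eq subsetD)

lemma finite_edges: "E \<subseteq> [V]\<^bsup>2\<^esup> \<Longrightarrow> finite V \<Longrightarrow> finite E"
  by (meson finite_imp_finite_nsets finite_subset)

fun edge_ball :: "'v set set \<Rightarrow> 'v set \<Rightarrow> nat \<Rightarrow> 'v set" where
  "edge_ball E U 0 = U"
| "edge_ball E U (Suc i) = edge_ball E U i \<union> (\<Union>u \<in> edge_ball E U i. \<Union>{d \<in> E. u \<in> d})"

lemma edge_ball_mono: "i \<le> j \<Longrightarrow> edge_ball E U i \<subseteq> edge_ball E U j"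
  by (rule lift_Suc_mono_le) simp_all

lemma edge_ball_step: "y \<in> edge_ball E U i \<Longrightarrow> {x, y} \<in> E \<Longrightarrow> x \<in> edge_ball E U (Suc i)"
  unfolding edge_ball.simps by (intro UnI2 UN_I[of y] UnionI[of "{x, y}"]) simp_all

lemma edge_ball_finite_card:
  assumes E: "E \<subseteq> [V]\<^bsup>2\<^esup>" "finite V" and U: "finite U" and deg: "\<And>u. degree E u \<le> \<Delta>"
  shows "finite (edge_ball E U i) \<and> card (edge_ball E U i) \<le> card U * (1 + 2 * \<Delta>) ^ i"
proof (induction i)
  case 0
  show ?case using U by simp
next
  case (Suc i)
  let ?B = "edge_ball E U i" and ?N = "\<lambda>u. \<Union>{d \<in> E. u \<in> d}"
  have finE: "finite E" using E finite_edges by blast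
  have N: "finite (?N u) \<and> card (?N u) \<le> 2 * \<Delta>" for u
  proof
    show "finite (?N u)" using finE E(1) by (auto simp: nsets_def)
    have "card (?N u) \<le> (\<Sum>d \<in> {d \<in> E. u \<in> d}. card d)"
      by (rule card_Union_le_sum_card)
    also have "\<dots> = (\<Sum>d \<in> {d \<in> E. u \<in> d}. 2)"
      by (rule sum.cong) (use E(1) in \<open>auto simp: nsets_def\<close>)
    also have "\<dots> = 2 * degree E u" by (simp add: degree_def)
    also have "\<dots> \<le> 2 * \<Delta>" using deg by simp
    finally show "card (?N u) \<le> 2 * \<Delta>" .
  qed
  have fin: "finite ?B" using Suc by simp
  have "card (edge_ball E U (Suc i)) \<le> card ?B + card (\<Union>u \<in> ?B. ?N u)"
    by (simp add: card_Un_le)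
  also have "card (\<Union>u \<in> ?B. ?N u) \<le> (\<Sum>u \<in> ?B. card (?N u))" using fin by (rule card_UN_le)
  also have "\<dots> \<le> card ?B * (2 * \<Delta>)"
    using sum_bounded_above[of ?B "\<lambda>u. card (?N u)" "2 * \<Delta>"] N by simp
  finally have "card (edge_ball E U (Suc i)) \<le> card ?B * (1 + 2 * \<Delta>)" by (simp add: algebra_simps)
  also have "\<dots> \<le> card U * (1 + 2 * \<Delta>) ^ i * (1 + 2 * \<Delta>)" using Suc by (intro mult_right_mono) auto
  finally show ?case using fin N by (simp add: algebra_simps)
qed

lemma degree_insert:
  assumes "finite E" "d \<notin> E"
  shows "degree (insert d E) v = degree E v + (if v \<in> d then 1 else 0)"
proof -
  have "{e \<in> insert d E. v \<in> e} = (if v \<in> d then insert d {e \<in> E. v \<in> e} else {e \<in> E. v \<in> e})" by auto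
  then show ?thesis unfolding degree_def using assms by simp
qed

section \<open>Gluing along small cuts\<close>

locale inseparable_graph =
  fixes H :: "'a graph"
  assumes fin: "fin_graph H" and insep: "inseparable_2_1 H"
begin

abbreviation "k \<equiv> card (verts H)"
abbreviation "h \<equiv> card (edges H)"

lemma finV: "finite (verts H)" and EH: "edges H \<subseteq> [verts H]\<^bsup>2\<^esup>"
  using fin by (auto simp: fin_graph_def)

lemma finE: "finite (edges H)"
  using finV EH by (meson finite_imp_finite_nsets finite_subset)

lemma connected_del:
  assumes "S \<subseteq> verts H" "card S \<le> 2" "d \<in> edges H" "d \<inter> S = {}"
  shows "connected_on (edges H - {d}) (verts H - S)"
proof -
  let ?G = "del_edge (del_verts H S) d"
  have "connected_graph ?G"
    using insep assms unfolding inseparable_2_1_def separable_2_1_def by (auto simp: del_verts_def)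
  moreover have "edges ?G \<subseteq> [verts ?G]\<^bsup>2\<^esup>"
    using EH unfolding del_edge_def del_verts_def nsets_def by auto
  ultimately have "connected_on (edges ?G) (verts ?G)" by (rule connected_graph_imp_connected_on)
  then have "connected_on (edges H - {d}) (verts ?G)"
    by (rule connected_on_mono) (auto simp: del_edge_def del_verts_def)
  then show ?thesis by (simp add: del_edge_def del_verts_def)
qed

lemma nbrs_ge_4:
  assumes v: "v \<in> verts H"
  shows "4 \<le> card {w. {v, w} \<in> edges H}"
proof (rule ccontr)
  let ?N = "{w. {v, w} \<in> edges H}"
  assume "\<not> ?thesis"
  then have c: "card ?N \<le> 3" by simp
  have N: "?N \<subseteq> verts H" "v \<notin> ?N" using edges_nsetsD[OF EH, of v] by blast+
  then have finN: "finite ?N" using finV finite_subset by blast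
  obtain d where d: "d \<in> edges H" using insep unfolding inseparable_2_1_def by blast
  then obtain x y where xy: "d = {x, y}" "x \<in> verts H" "y \<in> verts H" "x \<noteq> y"
    using EH nsets2_memE by metis
  have "connected_on (edges H - {d}) (verts H - {})" using d by (intro connected_del) auto
  moreover have "{v} \<subseteq> verts H - {}" "{v} \<noteq> {}" "{v} \<noteq> verts H - {}" using v xy by auto
  ultimately obtain w where w: "{v, w} \<in> edges H"
    by (rule connected_onE) (use that in auto)
  define S where "S = ?N - {w}"
  have "card S \<le> 2" unfolding S_def using w c finN by (simp add: card_Diff_singleton)
  then have "connected_on (edges H - {{v, w}}) (verts H - S)"
    using w N by (intro connected_del) (auto simp: S_def)
  moreover have "{v} \<subseteq> verts H - S" using v N S_def by auto
  moreover have "w \<in> verts H - S" "w \<noteq> v" using w N unfolding S_def by auto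
  then have "{v} \<noteq> verts H - S" by auto
  ultimately obtain u where "u \<in> verts H - S" "u \<noteq> v" "{v, u} \<in> edges H - {{v, w}}"
    using connected_onE[of _ _ "{v}"] by (metis empty_not_insert singletonD singletonI)
  then show False unfolding S_def using edges_nsetsD[OF EH] by auto
qed

lemma edge_avoiding:
  assumes "v \<in> verts H" "card S < 4" "finite S"
  obtains w where "{v, w} \<in> edges H" "w \<notin> S" "w \<in> verts H" "w \<noteq> v"
proof -
  have "\<not> {w. {v, w} \<in> edges H} \<subseteq> S"
  proof
    assume "{w. {v, w} \<in> edges H} \<subseteq> S"
    from card_mono[OF assms(3) this] show False using nbrs_ge_4[OF assms(1)] assms(2) by linarith
  qed
  then obtain w where w: "{v, w} \<in> edges H" "w \<notin> S" by auto
  then show ?thesis using that edges_nsetsD[OF EH w(1)] by auto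
qed

lemma k_ge_5: "5 \<le> k"
proof -
  obtain d where "d \<in> edges H" using insep unfolding inseparable_2_1_def by blast
  then obtain v where v: "v \<in> verts H" using EH nsets2_memE by metis
  let ?N = "{w. {v, w} \<in> edges H}"
  have N: "?N \<subseteq> verts H - {v}" using edges_nsetsD[OF EH, of v] by blast
  then have "4 \<le> card (verts H - {v})"
    using nbrs_ge_4[OF v] finV by (meson card_mono finite_Diff le_trans)
  then show ?thesis using v finV by (simp add: card_Diff_singleton)
qed

lemma three_connected_minus_edge:
  assumes d: "d \<in> edges H"
  shows "three_connected_on (edges H - {d}) (verts H)"
  unfolding three_connected_on_def
proof (intro allI impI)
  fix S assume S: "S \<subseteq> verts H" "card S \<le> 2"
  have finS: "finite S" using S finV finite_subset by blast
  show "connected_on (edges H - {d}) (verts H - S)"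
  proof (cases "d \<inter> S = {}")
    case True
    then show ?thesis using S d connected_del by blast
  next
    case False
    have "\<not> verts H \<subseteq> S" using S finS k_ge_5 card_mono by fastforce
    then obtain v where v: "v \<in> verts H" "v \<notin> S" by blast
    obtain w where w: "{v, w} \<in> edges H" "w \<notin> S" using edge_avoiding[of v S] v S finS by auto
    then have con: "connected_on (edges H - {{v, w}}) (verts H - S)"
      using S v by (intro connected_del) auto
    show ?thesis
      unfolding connected_on_def
    proof (intro allI impI)
      fix Y assume Y: "Y \<subseteq> verts H - S" "Y \<noteq> {}" "Y \<noteq> verts H - S"
      from connected_onE[OF con this] obtain x y
        where xy: "x \<in> Y" "y \<in> verts H - S" "y \<notin> Y" "{x, y} \<in> edges H - {{v, w}}" .
      then have "{x, y} \<inter> S = {}" using Y by blast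
      then have "{x, y} \<noteq> d" using False by metis
      then show "\<exists>u\<in>Y. \<exists>v\<in>verts H - S - Y. {u, v} \<in> edges H - {d}" using xy by blast
    qed
  qed
qed

lemma disjoint_edges:
  obtains e1 e2 f1 f2 where "{e1, e2} \<in> edges H" "{f1, f2} \<in> edges H" "distinct [e1, e2, f1, f2]"
    "{e1, e2, f1, f2} \<subseteq> verts H"
proof -
  obtain d where "d \<in> edges H" using insep unfolding inseparable_2_1_def by blast
  then obtain e1 e2 where e: "{e1, e2} \<in> edges H" "e1 \<in> verts H" "e2 \<in> verts H" "e1 \<noteq> e2"
    using EH nsets2_memE by metis
  have "\<not> verts H \<subseteq> {e1, e2}" using k_ge_5 card_mono[of "{e1, e2}" "verts H"] e by auto
  then obtain f1 where f1: "f1 \<in> verts H" "f1 \<noteq> e1" "f1 \<noteq> e2" by blast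
  obtain f2 where "{f1, f2} \<in> edges H" "f2 \<notin> {e1, e2}" "f2 \<in> verts H" "f2 \<noteq> f1"
    using edge_avoiding[of f1 "{e1, e2}"] f1 e by auto
  then show ?thesis using that e f1 by auto
qed

lemma completes_verts_subset:
  assumes "completes H Z e f d" "Z \<subseteq> [V]\<^bsup>2\<^esup>"
  shows "f ` verts H \<subseteq> V"
proof
  fix x assume "x \<in> f ` verts H"
  then obtain v where v: "v \<in> verts H" "x = f v" by blast
  have d: "d \<in> edges H" using assms(1) by (simp add: completes_def)
  then have "finite d" "card d = 2" using EH by (auto simp: nsets_def)
  then obtain w where "{v, w} \<in> edges H" "w \<notin> d" using edge_avoiding[of v d] v by auto
  then have "f ` {v, w} \<in> Z" using assms(1) unfolding completes_def by blast
  then show "x \<in> V" using v edges_nsetsD[OF assms(2)] by auto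
qed

lemma final_graph_closed:
  assumes "fin_graph G"
  shows "percolation_closed H (edges (final_graph H G))"
  unfolding percolation_closed_def
proof (intro allI impI)
  fix e f d assume c: "completes H (edges (final_graph H G)) e f d"
  let ?F = "final_graph H G"
  have F: "fin_graph ?F" unfolding final_graph_def using assms by (rule fin_graph_process)
  have st: "process_step H ?F = ?F"
    unfolding final_graph_def using running_time_stable[OF assms, of H] by simp
  have V: "f ` verts H \<subseteq> verts ?F"
    using completes_verts_subset[OF c] F unfolding fin_graph_def by blast
  have d: "d \<in> edges H" "inj_on f (verts H)" "f ` d = e" using c by (auto simp: completes_def)
  then have "d \<subseteq> verts H" "card d = 2" "finite d" using EH by (auto simp: nsets_def)
  then have "e \<in> [verts ?F]\<^bsup>2\<^esup>"
    using d V card_image[OF inj_on_subset[of f "verts H" d]] by (auto simp: nsets_def)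
  then have "e \<in> edges (process_step H ?F)"
    using process_step_iff[OF fin F, of e] V c by blast
  then show "e \<in> edges ?F" using st by simp
qed

lemma percolatingI:
  assumes G: "fin_graph G"
    and all: "\<And>Z d. percolation_closed H Z \<Longrightarrow> edges G \<subseteq> Z \<Longrightarrow> d \<in> [verts G]\<^bsup>2\<^esup> \<Longrightarrow> d \<in> Z"
  shows "percolating H G"
proof -
  let ?F = "final_graph H G"
  have "edges G \<subseteq> edges ?F"
    unfolding final_graph_def using process_edges_mono[of H G 0] by simp
  then have "[verts G]\<^bsup>2\<^esup> \<subseteq> edges ?F" using all final_graph_closed[OF G] by blast
  moreover have "verts ?F = verts G" by (simp add: final_graph_def)
  moreover have "edges ?F \<subseteq> [verts G]\<^bsup>2\<^esup>"
    using fin_graph_process[OF G, of H] unfolding fin_graph_def final_graph_def by simp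
  ultimately show ?thesis unfolding percolating_def complete_graph_def by (metis graph.exhaust_sel subset_antisym)
qed

lemma block_nsets:
  assumes "inj_on g (verts H)"
  shows "(\<lambda>d. g ` d) ` (edges H - D) \<subseteq> [g ` verts H]\<^bsup>2\<^esup>"
proof
  fix d assume "d \<in> (\<lambda>d. g ` d) ` (edges H - D)"
  then obtain d' where d': "d' \<in> edges H" "d = g ` d'" by auto
  then obtain u v where "d' = {u, v}" "u \<in> verts H" "v \<in> verts H" "u \<noteq> v"
    using nsets2_memE[OF d'(1) EH] by metis
  then show "d \<in> [g ` verts H]\<^bsup>2\<^esup>" using d'(2) assms by (auto dest: inj_onD)
qed

lemma block_image_mem:
  assumes "inj_on g (verts H)" "d0 \<in> edges H" "g ` d0 \<in> (\<lambda>d. g ` d) ` (edges H - D)"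
  shows "d0 \<notin> D"
proof -
  obtain d where d: "d \<in> edges H" "d \<notin> D" "g ` d0 = g ` d" using assms(3) by auto
  moreover have "d \<subseteq> verts H" "d0 \<subseteq> verts H" using d assms(2) EH by (auto simp: nsets_def)
  ultimately show ?thesis using assms(1) by (metis inj_on_image_eq_iff)
qed

text \<open>The bound \<open>h - 2\<close> excludes a copy of \<open>H\<close> minus an edge on \<open>X\<close>; a block \<open>H - e - f\<close> satisfies it.\<close>

definition sparse :: "'v set \<Rightarrow> 'v set set \<Rightarrow> bool" where
  "sparse W K \<longleftrightarrow> (\<forall>X. card X = k \<longrightarrow> \<not> X \<subseteq> W \<longrightarrow> three_connected_on K X \<longrightarrow>
     card (K \<inter> [X]\<^bsup>2\<^esup>) + 2 \<le> h)"

lemma three_connected_subset: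
  assumes "three_connected_on K X" "K \<subseteq> [V]\<^bsup>2\<^esup>" "card X = k"
  shows "X \<subseteq> V"
proof
  fix x assume x: "x \<in> X"
  have ne: "{x} \<noteq> X" using assms(3) k_ge_5 by auto
  obtain u v where "u \<in> {x}" "{u, v} \<in> K"
    by (rule three_connected_onD[OF assms(1), of "{}" "{x}"]) (use x ne in auto)
  then show "x \<in> V" using edges_nsetsD[OF assms(2)] by auto
qed

text \<open>Since \<open>X\<close> has only \<open>k\<close> vertices, it misses a level of \<open>\<phi>\<close> between \<open>P\<close> and \<open>Q\<close>. Its part in \<open>V2\<close> then
  splits into two pieces, which \<open>P\<close> and \<open>Q\<close>, respectively, separate from the rest of \<open>X\<close>.\<close>

lemma glue_cases:
  fixes \<phi> :: "'v \<Rightarrow> nat"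
  assumes K1: "K1 \<subseteq> [V1]\<^bsup>2\<^esup>" and K2: "K2 \<subseteq> [V2]\<^bsup>2\<^esup>" and V: "V1 \<inter> V2 = P \<union> Q"
    and P: "finite P" "card P \<le> 2" and Q: "finite Q" "card Q \<le> 2"
    and phiP: "\<And>v. v \<in> P \<Longrightarrow> \<phi> v = 0" and phiQ: "\<And>v. v \<in> Q \<Longrightarrow> k \<le> \<phi> v"
    and lip: "\<And>u v. {u, v} \<in> K2 \<Longrightarrow> \<phi> u \<le> \<phi> v + 1"
    and tc: "three_connected_on (K1 \<union> K2) X" and X: "card X = k"
  shows "X \<subseteq> V1 \<or> X \<subseteq> V2 \<and> (X \<inter> P = {} \<or> X \<inter> Q = {})"
proof -
  have finX: "finite X" using X k_ge_5 by (intro card_ge_0_finite) auto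
  have "K1 \<union> K2 \<subseteq> [V1 \<union> V2]\<^bsup>2\<^esup>"
    using K1 K2 nsets_mono[of V1 "V1 \<union> V2" 2] nsets_mono[of V2 "V1 \<union> V2" 2] by blast
  then have XV: "X \<subseteq> V1 \<union> V2" using three_connected_subset[OF tc _ X] by blast
  have "\<not> {..k} \<subseteq> \<phi> ` X"
  proof
    assume "{..k} \<subseteq> \<phi> ` X"
    then have "card {..k} \<le> card (\<phi> ` X)" using finX by (intro card_mono) auto
    also have "\<dots> \<le> k" using card_image_le[OF finX] X by simp
    finally show False by simp
  qed
  then obtain j where j: "j \<le> k" "\<And>x. x \<in> X \<Longrightarrow> \<phi> x \<noteq> j" by auto
  define U where "U = {x \<in> X \<inter> V2. \<phi> x < j}"
  define U' where "U' = {x \<in> X \<inter> V2. j < \<phi> x}"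
  have UU: "X \<inter> V2 = U \<union> U'" "U \<inter> U' = {}" unfolding U_def U'_def using j(2) by force+
  have noedge: False if "u \<in> U" "v \<in> U'" "{u, v} \<in> K2" for u v
    using that lip[of v u] unfolding U_def U'_def by (auto simp: insert_commute)
  have PU: "P \<inter> X \<subseteq> U"
  proof
    fix x assume x: "x \<in> P \<inter> X"
    then show "x \<in> U" unfolding U_def using phiP[of x] V j(2)[of x] by auto
  qed
  have QU: "Q \<inter> X \<subseteq> U'"
  proof
    fix x assume x: "x \<in> Q \<inter> X"
    then show "x \<in> U'" unfolding U'_def using phiQ[of x] V j(1) j(2)[of x] by auto
  qed
  have side: "A - R = {} \<or> A - R = X - R"
    if *: "A \<union> A' = X \<inter> V2" "R' \<inter> X \<subseteq> A'" "A \<inter> A' = {}" "P \<union> Q = R \<union> R'" "finite R" "card R \<le> 2"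
      "\<And>u v. u \<in> A \<Longrightarrow> v \<in> A' \<Longrightarrow> {u, v} \<in> K2 \<Longrightarrow> False" for A A' R R'
  proof (rule ccontr)
    assume "\<not> ?thesis"
    then obtain u v where uv: "u \<in> A - R" "v \<in> X" "v \<notin> R" "v \<notin> A - R" "{u, v} \<in> K1 \<union> K2"
      using three_connected_onD[OF tc *(5,6), of "A - R"] *(1) by auto
    have "u \<notin> V1" using uv(1) *(1-4) V by blast
    then have "{u, v} \<in> K2" using uv(5) edges_nsetsD[OF K1] by auto
    moreover from this have "v \<in> V2" using edges_nsetsD[OF K2] by auto
    then have "v \<in> A'" using uv *(1) by auto
    ultimately show False using *(7) uv(1) by auto
  qed
  have s1: "U - P = {} \<or> U - P = X - P"
    by (rule side[of U U' Q P]) (use UU PU QU P noedge in auto)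
  have s2: "U' - Q = {} \<or> U' - Q = X - Q"
  proof (rule side[of U' U P Q])
    show "False" if "u \<in> U'" "v \<in> U" "{u, v} \<in> K2" for u v
      using noedge[of v u] that by (simp add: insert_commute)
  qed (use UU PU QU Q in auto)
  have UV: "U \<subseteq> V2" "U' \<subseteq> V2" unfolding U_def U'_def by auto
  consider "U - P = X - P" | "U' - Q = X - Q" | "U - P = {}" "U' - Q = {}" using s1 s2 by blast
  then show ?thesis
  proof cases
    case 1
    then have "X \<subseteq> U \<union> P" by auto
    then have "X \<subseteq> V2" "X \<inter> Q = {}" using V UU(2) QU PU UV by blast+
    then show ?thesis by simp
  next
    case 2
    then have "X \<subseteq> U' \<union> Q" by auto
    then have "X \<subseteq> V2" "X \<inter> P = {}" using V UU(2) QU PU UV by blast+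
    then show ?thesis by simp
  next
    case 3
    then have "X \<subseteq> V1" using UU(1) V XV by blast
    then show ?thesis by simp
  qed
qed

lemma sparse_glue:
  fixes \<phi> :: "'v \<Rightarrow> nat"
  assumes K1: "K1 \<subseteq> [V1]\<^bsup>2\<^esup>" and K2: "K2 \<subseteq> [V2]\<^bsup>2\<^esup>" and V: "V1 \<inter> V2 = P \<union> Q"
    and P: "finite P" "card P \<le> 2" and Q: "finite Q" "card Q \<le> 2"
    and phiP: "\<And>v. v \<in> P \<Longrightarrow> \<phi> v = 0" and phiQ: "\<And>v. v \<in> Q \<Longrightarrow> k \<le> \<phi> v"
    and lip: "\<And>u v. {u, v} \<in> K2 \<Longrightarrow> \<phi> u \<le> \<phi> v + 1"
    and nonadj: "\<And>d. d \<in> K1 \<union> K2 \<Longrightarrow> \<not> d \<subseteq> P \<and> \<not> d \<subseteq> Q"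
    and sp: "sparse W K1" "sparse W K2"
  shows "sparse W (K1 \<union> K2)"
  unfolding sparse_def
proof (intro allI impI)
  fix X assume X: "card X = k" "\<not> X \<subseteq> W" and tc: "three_connected_on (K1 \<union> K2) X"
  have conclude: "card ((K1 \<union> K2) \<inter> [X]\<^bsup>2\<^esup>) + 2 \<le> h"
    if eq: "(K1 \<union> K2) \<inter> [X]\<^bsup>2\<^esup> \<subseteq> K" and K: "K \<subseteq> K1 \<union> K2" "sparse W K" for K
  proof -
    have "three_connected_on K X"
    proof (rule three_connected_on_mono[OF tc])
      fix u v assume uv: "u \<in> X" "v \<in> X" "{u, v} \<in> K1 \<union> K2"
      then have "u \<noteq> v" using edges_nsetsD[OF K1] edges_nsetsD[OF K2] by auto
      then have "{u, v} \<in> [X]\<^bsup>2\<^esup>" using uv by simp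
      then show "{u, v} \<in> K" using eq uv(3) by blast
    qed
    then have "card (K \<inter> [X]\<^bsup>2\<^esup>) + 2 \<le> h" using K(2) X unfolding sparse_def by blast
    moreover have "(K1 \<union> K2) \<inter> [X]\<^bsup>2\<^esup> = K \<inter> [X]\<^bsup>2\<^esup>" using eq K(1) by blast
    ultimately show ?thesis by simp
  qed
  from glue_cases[OF K1 K2 V P Q phiP phiQ lip tc X(1)]
  show "card ((K1 \<union> K2) \<inter> [X]\<^bsup>2\<^esup>) + 2 \<le> h"
  proof
    assume X1: "X \<subseteq> V1"
    have "d \<in> K1" if d: "d \<in> K1 \<union> K2" "d \<in> [X]\<^bsup>2\<^esup>" for d
    proof (rule ccontr)
      assume "d \<notin> K1"
      then have d2: "d \<in> K2" using d by blast
      obtain u v where uv: "d = {u, v}" "u \<in> V2" "v \<in> V2" using nsets2_memE[OF d2 K2] by metis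
      then have "u \<in> P \<union> Q" "v \<in> P \<union> Q" using V d(2) X1 by (auto simp: nsets_def)
      moreover have "\<not> {u, v} \<subseteq> P" "\<not> {u, v} \<subseteq> Q" using nonadj[OF d(1)] uv(1) by auto
      ultimately have "u \<in> P \<and> v \<in> Q \<or> u \<in> Q \<and> v \<in> P" by auto
      then show False
        using lip[of u v] lip[of v u] d2 uv(1) phiP[of u] phiP[of v] phiQ[of u] phiQ[of v] k_ge_5
        by (auto simp: insert_commute)
    qed
    then show ?thesis using sp by (intro conclude[of K1]) auto
  next
    assume X2: "X \<subseteq> V2 \<and> (X \<inter> P = {} \<or> X \<inter> Q = {})"
    have "d \<in> K2" if d: "d \<in> K1 \<union> K2" "d \<in> [X]\<^bsup>2\<^esup>" for d
    proof (rule ccontr)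
      assume "d \<notin> K2"
      then have d1: "d \<in> K1" using d by blast
      have "d \<subseteq> V1" using d1 K1 by (auto simp: nsets_def)
      moreover have "d \<subseteq> X" using d(2) by (auto simp: nsets_def)
      ultimately have "d \<subseteq> P \<or> d \<subseteq> Q" using V X2 by blast
      then show False using nonadj[OF d(1)] by blast
    qed
    then show ?thesis using sp by (intro conclude[of K2]) auto
  qed
qed

lemma sparse_insert_edge:
  fixes \<phi> :: "'v \<Rightarrow> nat"
  assumes K: "K \<subseteq> [V]\<^bsup>2\<^esup>" and uv: "u \<in> V" "v \<in> V" "u \<noteq> v"
    and phi: "\<phi> u = 0" "k \<le> \<phi> v" and lip: "\<And>x y. {x, y} \<in> K \<Longrightarrow> \<phi> x \<le> \<phi> y + 1"
    and sp: "sparse W K"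
  shows "sparse W (insert {u, v} K)"
proof -
  have "sparse W ({{u, v}} \<union> K)"
  proof (rule sparse_glue[where P = "{u}" and Q = "{v}" and ?V1.0 = "{u, v}" and ?V2.0 = V and \<phi> = \<phi>])
    show "{{u, v}} \<subseteq> [{u, v}]\<^bsup>2\<^esup>" using uv by simp
    show "\<not> d \<subseteq> {u} \<and> \<not> d \<subseteq> {v}" if d: "d \<in> {{u, v}} \<union> K" for d
    proof -
      obtain x y where "d = {x, y}" "x \<noteq> y"
      proof (cases "d \<in> K")
        case True
        then show ?thesis using nsets2_memE[OF True K] that by metis
      next
        case False
        then show ?thesis using d uv that by auto
      qed
      then show ?thesis by auto
    qed
    show "sparse W {{u, v}}"
      unfolding sparse_def
    proof (intro allI impI)
      fix X assume X: "card X = k" "three_connected_on {{u, v}} X"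
      have "X \<subseteq> {u, v}" using three_connected_subset[OF X(2) _ X(1), of "{u, v}"] uv by simp
      then have "card X \<le> card {u, v}" by (intro card_mono) auto
      then show "card ({{u, v}} \<inter> [X]\<^bsup>2\<^esup>) + 2 \<le> h" using X(1) k_ge_5 uv by simp
    qed
  qed (use assms in auto)
  then show ?thesis by simp
qed

text \<open>Per vertex of the clique \<open>Y\<close> there are at most \<open>k + 1\<close> prescribed pairs, each costing \<open>(k + 3) k\<close> new
  vertices. The degree cap leaves at least half of \<open>Y\<close> unsaturated throughout the greedy phase, and
  half of \<open>Y\<close> is larger than any ball of radius \<open>k\<close>.\<close>

definition latent_cost :: nat where "latent_cost = (k + 1) * ((k + 3) * k)"

definition degree_cap :: nat where
  "degree_cap = 2 * (h * (2 * k + 1) + k * (1 + latent_cost)) + 3 * h + k"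

definition clique_size :: "nat \<Rightarrow> nat" where
  "clique_size n = 2 * (n + 1) * (1 + 2 * degree_cap) ^ k + 1"

lemma clique_size_ge: "n \<le> clique_size n"
proof -
  have "n * 1 \<le> (2 * (n + 1)) * (1 + 2 * degree_cap) ^ k" by (intro mult_mono) auto
  then show ?thesis unfolding clique_size_def by simp
qed

end

section \<open>Attachments triggered by an edge\<close>

locale triggered_graph = inseparable_graph H for H :: "'a graph" +
  fixes W :: "nat set" and a b :: nat
  assumes finW: "finite W" and ab: "a \<in> W" "b \<in> W" "a \<noteq> b"
begin

text \<open>Nothing is assumed about the edges inside \<open>W\<close> except that \<open>ab\<close> is missing, so that the same
  attachment serves every stage of the process on \<open>W\<close> before \<open>ab\<close> is added.\<close>

definition background :: "nat set set \<Rightarrow> nat set set" where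
  "background E = E \<union> ([W]\<^bsup>2\<^esup> - {{a, b}})"

definition forced :: "nat set set \<Rightarrow> nat set \<Rightarrow> bool" where
  "forced E d \<longleftrightarrow> (\<forall>Z. percolation_closed H Z \<longrightarrow> insert {a, b} E \<subseteq> Z \<longrightarrow> d \<in> Z)"

definition attachment :: "nat set \<Rightarrow> nat set set \<Rightarrow> bool" where
  "attachment V E \<longleftrightarrow> finite V \<and> W \<subseteq> V \<and> E \<subseteq> [V]\<^bsup>2\<^esup> \<and> (\<forall>d \<in> E. \<not> d \<subseteq> W) \<and> sparse W (background E)"

lemma forced_mono: "forced E d \<Longrightarrow> E \<subseteq> E' \<Longrightarrow> forced E' d"
  unfolding forced_def by auto

lemma attachmentD:
  assumes "attachment V E"
  shows "finite V" "W \<subseteq> V" "E \<subseteq> [V]\<^bsup>2\<^esup>" "d \<in> E \<Longrightarrow> \<not> d \<subseteq> W" "sparse W (background E)"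
  using assms unfolding attachment_def by auto

lemma background_nsets:
  assumes "attachment V E"
  shows "background E \<subseteq> [V]\<^bsup>2\<^esup>"
  using attachmentD[OF assms] nsets_mono[of W V 2] unfolding background_def by auto

lemma background_Un: "background (E \<union> B) = B \<union> background E"
  unfolding background_def by auto

lemma attach_block:
  fixes \<phi> :: "nat \<Rightarrow> nat"
  assumes att: "attachment V E"
    and e: "{e1, e2} \<in> edges H" "{f1, f2} \<in> edges H" "{e1, e2} \<noteq> {f1, f2}"
    and g: "inj_on g (verts H)"
    and V: "g ` verts H \<inter> V = P \<union> Q"
    and P: "finite P" "card P \<le> 2" and Q: "finite Q" "card Q \<le> 2"
    and phiP: "\<And>v. v \<in> P \<Longrightarrow> \<phi> v = 0" and phiQ: "\<And>v. v \<in> Q \<Longrightarrow> k \<le> \<phi> v"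
    and lip: "\<And>u v. {u, v} \<in> background E \<Longrightarrow> \<phi> u \<le> \<phi> v + 1"
    and B: "B = (\<lambda>d. g ` d) ` (edges H - {{e1, e2}, {f1, f2}})"
    and nonadj: "\<And>d. d \<in> B \<union> background E \<Longrightarrow> \<not> d \<subseteq> P \<and> \<not> d \<subseteq> Q"
    and BW: "\<And>d. d \<in> B \<Longrightarrow> \<not> d \<subseteq> W"
    and forced: "forced E (g ` {e1, e2})"
  shows "attachment (V \<union> g ` verts H) (E \<union> B)" "B \<subseteq> [g ` verts H]\<^bsup>2\<^esup>" "card B \<le> h" "finite B"
    "forced (E \<union> B) (g ` {f1, f2})"
proof -
  have "card (edges H - {{e1, e2}, {f1, f2}}) + 2 = h"
    using card_Diff_subset[of "{{e1, e2}, {f1, f2}}" "edges H"] e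
      card_mono[OF finE, of "{{e1, e2}, {f1, f2}}"] by auto
  moreover have "card B \<le> card (edges H - {{e1, e2}, {f1, f2}})"
    unfolding B using finE by (intro card_image_le) auto
  ultimately have cB: "card B + 2 \<le> h" by linarith
  then show "card B \<le> h" by simp
  show finB: "finite B" unfolding B using finE by auto
  show BV: "B \<subseteq> [g ` verts H]\<^bsup>2\<^esup>" unfolding B using g by (rule block_nsets)
  have "sparse W B" unfolding sparse_def
  proof (intro allI impI)
    fix X
    have "card (B \<inter> [X]\<^bsup>2\<^esup>) \<le> card B" using finB by (intro card_mono) auto
    then show "card (B \<inter> [X]\<^bsup>2\<^esup>) + 2 \<le> h" using cB by simp
  qed
  then have "sparse W (B \<union> background E)"
    using attachmentD(5)[OF att]
    by (intro sparse_glue[OF BV background_nsets[OF att] V P Q phiP phiQ lip nonadj])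
  then have "sparse W (background (E \<union> B))" by (simp add: background_Un)
  moreover have "E \<union> B \<subseteq> [V \<union> g ` verts H]\<^bsup>2\<^esup>"
    using attachmentD(3)[OF att] BV nsets_mono[of V "V \<union> g ` verts H" 2]
      nsets_mono[of "g ` verts H" "V \<union> g ` verts H" 2] by blast
  ultimately show "attachment (V \<union> g ` verts H) (E \<union> B)"
    unfolding attachment_def using attachmentD[OF att] BW finV by auto
  show "forced (E \<union> B) (g ` {f1, f2})"
    unfolding forced_def
  proof (intro allI impI)
    fix Z assume Z: "percolation_closed H Z" "insert {a, b} (E \<union> B) \<subseteq> Z"
    have "g ` {e1, e2} \<in> Z" using forced Z unfolding forced_def by blast
    then have "\<forall>d \<in> edges H - {{f1, f2}}. g ` d \<in> Z" using Z(2) unfolding B by blast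
    then have "completes H Z (g ` {f1, f2}) g {f1, f2}" unfolding completes_def using g e by blast
    then show "g ` {f1, f2} \<in> Z" using Z(1) unfolding percolation_closed_def by blast
  qed
qed

lemma open_block:
  assumes att: "attachment V E"
    and pq: "p \<in> V" "q \<in> V" "p \<noteq> q" "{p, q} \<notin> background E" "forced E {p, q}"
  obtains N p' q' B where "finite N" "N \<inter> V = {}" "card N \<le> k"
    "p' \<in> N" "q' \<in> N" "p' \<noteq> q'" "attachment (V \<union> N) (E \<union> B)" "B \<subseteq> [N \<union> {p, q}]\<^bsup>2\<^esup>"
    "\<forall>d \<in> B. \<not> d \<subseteq> V" "{p', q'} \<notin> B" "forced (E \<union> B) {p', q'}" "card B \<le> h" "finite B"
proof -
  obtain e1 e2 f1 f2 where ef: "{e1, e2} \<in> edges H" "{f1, f2} \<in> edges H"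
    "distinct [e1, e2, f1, f2]" "{e1, e2, f1, f2} \<subseteq> verts H" by (rule disjoint_edges)
  define A where "A = verts H - {e1, e2}"
  have finA: "finite A" unfolding A_def using finV by simp
  obtain g0 where g0: "inj_on g0 A" "g0 ` A \<inter> V = {}"
    by (rule fresh_injection[OF finA attachmentD(1)[OF att]])
  define g where "g v = (if v = e1 then p else if v = e2 then q else g0 v)" for v
  have gA: "g ` A = g0 ` A" unfolding A_def g_def by (intro image_cong) auto
  have HA: "verts H = {e1, e2} \<union> A" unfolding A_def using ef by auto
  have g_e: "g e1 = p" "g e2 = q" unfolding g_def using ef by auto
  have gH: "g ` verts H = {p, q} \<union> g0 ` A" unfolding HA image_Un gA using g_e by auto
  have inj: "inj_on g (verts H)"
    unfolding HA
  proof (rule inj_on_Un[THEN iffD2], intro conjI)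
    show "inj_on g {e1, e2}" using g_e pq by (auto simp: inj_on_def)
    have "\<forall>v \<in> A. g v = g0 v" unfolding A_def g_def by auto
    then show "inj_on g A" using g0(1) by (simp add: inj_on_def)
    show "g ` ({e1, e2} - A) \<inter> g ` (A - {e1, e2}) = {}"
      using g0(2) g_e pq gA unfolding A_def by auto
  qed
  define B where "B = (\<lambda>d. g ` d) ` (edges H - {{e1, e2}, {f1, f2}})"
  have ne: "{e1, e2} \<noteq> {f1, f2}" using ef(3) by (auto simp: doubleton_eq_iff)
  have "g ` {e1, e2} \<notin> B" "g ` {f1, f2} \<notin> B"
    unfolding B_def
    by (rule notI, drule block_image_mem[OF inj ef(1)], simp)
       (rule notI, drule block_image_mem[OF inj ef(2)], simp)
  then have notB: "{p, q} \<notin> B" "{g f1, g f2} \<notin> B" using g_e by simp_all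
  have BV: "B \<subseteq> [g ` verts H]\<^bsup>2\<^esup>" unfolding B_def using inj by (rule block_nsets)
  have not_sub: "\<not> d \<subseteq> {p, q}" if "d \<in> B \<union> background E" for d
  proof
    assume "d \<subseteq> {p, q}"
    moreover have "d \<in> [g ` verts H]\<^bsup>2\<^esup> \<or> d \<in> [V]\<^bsup>2\<^esup>" using that BV background_nsets[OF att] by auto
    ultimately have "d = {p, q}" using nsets2_subset_pair by metis
    then show False using that notB pq by auto
  qed
  have BnV: "\<not> d \<subseteq> V" if "d \<in> B" for d
  proof
    assume "d \<subseteq> V"
    moreover have "d \<subseteq> g ` verts H" using that BV by (auto simp: nsets_def)
    ultimately have "d \<subseteq> {p, q}" unfolding gH using g0(2) by blast
    then show False using not_sub that by auto
  qed
  have BW: "\<not> d \<subseteq> W" if "d \<in> B" for d using BnV[OF that] attachmentD(2)[OF att] by blast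
  have nonempty: "d \<noteq> {}" if "d \<in> B \<union> background E" for d using not_sub[OF that] by auto
  have gV: "g ` verts H \<inter> V = {p, q} \<union> {}" using gH g0(2) pq by auto
  have block: "attachment (V \<union> g ` verts H) (E \<union> B)" "B \<subseteq> [g ` verts H]\<^bsup>2\<^esup>" "card B \<le> h" "finite B"
    "forced (E \<union> B) (g ` {f1, f2})"
    by (rule attach_block[where \<phi> = "\<lambda>_. 0", OF att ef(1,2) ne inj gV _ _ _ _ _ _ _ B_def];
        use pq not_sub nonempty BW g_e in \<open>simp add: card_insert_if\<close>)+
  have V_eq: "V \<union> g ` verts H = V \<union> g0 ` A" using gH pq by auto
  have fA: "f1 \<in> A" "f2 \<in> A" "f1 \<noteq> f2" unfolding A_def using ef by auto
  show ?thesis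
  proof (rule that[of "g0 ` A" "g f1" "g f2" B])
    have "card (g0 ` A) \<le> card A" using finA by (rule card_image_le)
    also have "\<dots> \<le> k" unfolding A_def using finV by (intro card_mono) auto
    finally show "card (g0 ` A) \<le> k" .
    show "g f1 \<in> g0 ` A" "g f2 \<in> g0 ` A" using fA gA by blast+
    show "g f1 \<noteq> g f2" using inj fA ef(4) by (auto dest: inj_onD)
    show "attachment (V \<union> g0 ` A) (E \<union> B)" using block(1) V_eq by simp
    show "B \<subseteq> [g0 ` A \<union> {p, q}]\<^bsup>2\<^esup>" using BV gH by (simp add: Un_commute)
    show "forced (E \<union> B) {g f1, g f2}" using block(5) by simp
  qed (use finA g0 BnV notB block in auto)
qed

lemma close_block:
  fixes \<phi> :: "nat \<Rightarrow> nat"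
  assumes att: "attachment V E"
    and pq: "p \<in> V" "q \<in> V" "p \<noteq> q" "{p, q} \<notin> background E" "forced E {p, q}" "p \<notin> W" "q \<notin> W"
    and xy: "x \<in> V" "y \<in> V" "x \<noteq> y" "{x, y} \<notin> background E"
    and phi: "\<phi> x = 0" "\<phi> y = 0" "k \<le> \<phi> p" "k \<le> \<phi> q"
    and lip: "\<And>u v. {u, v} \<in> background E \<Longrightarrow> \<phi> u \<le> \<phi> v + 1"
  obtains N B where "finite N" "N \<inter> V = {}" "card N \<le> k"
    "attachment (V \<union> N) (E \<union> B)" "B \<subseteq> [N \<union> {p, q, x, y}]\<^bsup>2\<^esup>"
    "\<forall>d \<in> B. \<not> d \<subseteq> {x, y}"
    "forced (E \<union> B) {x, y}" "card B \<le> h" "finite B"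
proof -
  obtain e1 e2 f1 f2 where ef: "{e1, e2} \<in> edges H" "{f1, f2} \<in> edges H"
    "distinct [e1, e2, f1, f2]" "{e1, e2, f1, f2} \<subseteq> verts H" by (rule disjoint_edges)
  define A where "A = verts H - {e1, e2, f1, f2}"
  have finA: "finite A" unfolding A_def using finV by simp
  obtain g0 where g0: "inj_on g0 A" "g0 ` A \<inter> V = {}"
    by (rule fresh_injection[OF finA attachmentD(1)[OF att]])
  define g where "g v = (if v = e1 then p else if v = e2 then q else if v = f1 then x
    else if v = f2 then y else g0 v)" for v
  have gA: "g ` A = g0 ` A" unfolding A_def g_def by (intro image_cong) auto
  have HA: "verts H = {e1, e2, f1, f2} \<union> A" unfolding A_def using ef by auto
  have g_e: "g e1 = p" "g e2 = q" "g f1 = x" "g f2 = y" unfolding g_def using ef by auto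
  have dist: "distinct [p, q, x, y]" using pq xy phi k_ge_5 by auto
  have gH: "g ` verts H = {p, q, x, y} \<union> g0 ` A" unfolding HA image_Un gA using g_e by auto
  have inj: "inj_on g (verts H)"
    unfolding HA
  proof (rule inj_on_Un[THEN iffD2], intro conjI)
    show "inj_on g {e1, e2, f1, f2}" using g_e dist by (auto simp: inj_on_def)
    have "\<forall>v \<in> A. g v = g0 v" unfolding A_def g_def by auto
    then show "inj_on g A" using g0(1) by (simp add: inj_on_def)
    have "g ` {e1, e2, f1, f2} \<subseteq> V" using g_e pq xy by auto
    then show "g ` ({e1, e2, f1, f2} - A) \<inter> g ` (A - {e1, e2, f1, f2}) = {}"
      using g0(2) gA by blast
  qed
  define B where "B = (\<lambda>d. g ` d) ` (edges H - {{e1, e2}, {f1, f2}})"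
  have ne: "{e1, e2} \<noteq> {f1, f2}" using ef(3) by (auto simp: doubleton_eq_iff)
  have "g ` {e1, e2} \<notin> B" "g ` {f1, f2} \<notin> B"
    unfolding B_def
    by (rule notI, drule block_image_mem[OF inj ef(1)], simp)
       (rule notI, drule block_image_mem[OF inj ef(2)], simp)
  then have notB: "{p, q} \<notin> B" "{x, y} \<notin> B" using g_e by simp_all
  have BV: "B \<subseteq> [g ` verts H]\<^bsup>2\<^esup>" unfolding B_def using inj by (rule block_nsets)
  have not_sub: "\<not> d \<subseteq> {x, y} \<and> \<not> d \<subseteq> {p, q}" if "d \<in> B \<union> background E" for d
  proof -
    have "d \<in> [g ` verts H]\<^bsup>2\<^esup> \<or> d \<in> [V]\<^bsup>2\<^esup>" using that BV background_nsets[OF att] by auto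
    then have "d \<subseteq> {u, v} \<Longrightarrow> d = {u, v}" for u v using nsets2_subset_pair by metis
    then show ?thesis using that notB pq xy by auto
  qed
  have BW: "\<not> d \<subseteq> W" if "d \<in> B" for d
  proof
    assume "d \<subseteq> W"
    moreover have "d \<subseteq> g ` verts H" using that BV by (auto simp: nsets_def)
    ultimately have "d \<subseteq> {x, y}" unfolding gH using g0(2) attachmentD(2)[OF att] pq(6,7) by blast
    then show False using not_sub that by auto
  qed
  have phi0: "\<phi> v = 0" if "v \<in> {x, y}" for v using that phi by auto
  have phik: "k \<le> \<phi> v" if "v \<in> {p, q}" for v using that phi by auto
  have gV: "g ` verts H \<inter> V = {x, y} \<union> {p, q}" using gH g0(2) pq xy by auto
  have block: "attachment (V \<union> g ` verts H) (E \<union> B)" "B \<subseteq> [g ` verts H]\<^bsup>2\<^esup>" "card B \<le> h" "finite B"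
    "forced (E \<union> B) (g ` {f1, f2})"
    by (rule attach_block[OF att ef(1,2) ne inj gV _ _ _ _ phi0 phik lip B_def];
        use pq not_sub BW g_e in \<open>simp add: card_insert_if\<close>)+
  have V_eq: "V \<union> g ` verts H = V \<union> g0 ` A" using gH pq xy by auto
  show ?thesis
  proof (rule that[of "g0 ` A" B])
    have "card (g0 ` A) \<le> card A" using finA by (rule card_image_le)
    also have "\<dots> \<le> k" unfolding A_def using finV by (intro card_mono) auto
    finally show "card (g0 ` A) \<le> k" .
    show "attachment (V \<union> g0 ` A) (E \<union> B)" using block(1) V_eq by simp
    show "B \<subseteq> [g0 ` A \<union> {p, q, x, y}]\<^bsup>2\<^esup>" using BV gH by (simp add: Un_commute)
    show "forced (E \<union> B) {x, y}" using block(5) g_e by simp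
  qed (use finA g0 not_sub block in auto)
qed

lemma attachment_finite_edges: "attachment V E \<Longrightarrow> finite E"
  using attachmentD finite_edges by metis

lemma chain:
  assumes att: "attachment V E"
    and pq: "p \<in> V" "q \<in> V" "p \<noteq> q" "{p, q} \<notin> background E" "forced E {p, q}"
  obtains N p' q' B and \<phi> :: "nat \<Rightarrow> nat" where "finite N" "N \<inter> V = {}" "card N \<le> Suc j * k"
    "p' \<in> N" "q' \<in> N" "p' \<noteq> q'" "attachment (V \<union> N) (E \<union> B)" "finite B" "B \<subseteq> [N \<union> {p, q}]\<^bsup>2\<^esup>"
    "\<forall>d \<in> B. \<not> d \<subseteq> V" "{p', q'} \<notin> background (E \<union> B)" "forced (E \<union> B) {p', q'}"
    "degree B p \<le> h" "degree B q \<le> h" "\<forall>v \<in> N. degree B v \<le> 2 * h"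
    "degree B p' \<le> h" "degree B q' \<le> h"
    "\<forall>v \<in> V. \<phi> v = 0" "\<phi> p' = Suc j" "\<phi> q' = Suc j"
    "\<forall>u v. {u, v} \<in> background (E \<union> B) \<longrightarrow> \<phi> u \<le> \<phi> v + 1"
proof (induction j arbitrary: thesis)
  case 0
  obtain N p' q' B where N: "finite N" "N \<inter> V = {}" "card N \<le> k"
    "p' \<in> N" "q' \<in> N" "p' \<noteq> q'" "attachment (V \<union> N) (E \<union> B)" "B \<subseteq> [N \<union> {p, q}]\<^bsup>2\<^esup>"
    "\<forall>d \<in> B. \<not> d \<subseteq> V" "{p', q'} \<notin> B" "forced (E \<union> B) {p', q'}" "card B \<le> h" "finite B"
    by (rule open_block[OF att pq])
  have "p' \<notin> V" "q' \<notin> V" using N by auto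
  then have "{p', q'} \<notin> background E" using edges_nsetsD[OF background_nsets[OF att]] by auto
  then have nonadj: "{p', q'} \<notin> background (E \<union> B)" using N(10) by (simp add: background_Un)
  have deg: "degree B v \<le> h" for v using degree_le_card[OF N(13), of v] N(12) by linarith
  then have deg2: "degree B v \<le> 2 * h" for v by (simp add: trans_le_add1 mult_2)
  show ?case
    by (rule 0[of N p' q' B "\<lambda>v. if v \<in> V then 0 else 1"])
       (use N \<open>p' \<notin> V\<close> \<open>q' \<notin> V\<close> deg deg2 nonadj in simp_all)
next
  case (Suc j)
  obtain N p' q' B and \<phi> :: "nat \<Rightarrow> nat" where N: "finite N" "N \<inter> V = {}" "card N \<le> Suc j * k"
    "p' \<in> N" "q' \<in> N" "p' \<noteq> q'" "attachment (V \<union> N) (E \<union> B)" "finite B" "B \<subseteq> [N \<union> {p, q}]\<^bsup>2\<^esup>"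
    and BV: "\<forall>d \<in> B. \<not> d \<subseteq> V"
    and p': "{p', q'} \<notin> background (E \<union> B)" "forced (E \<union> B) {p', q'}"
    and deg: "degree B p \<le> h" "degree B q \<le> h" "\<forall>v \<in> N. degree B v \<le> 2 * h"
      "degree B p' \<le> h" "degree B q' \<le> h"
    and phi: "\<forall>v \<in> V. \<phi> v = 0" "\<phi> p' = Suc j" "\<phi> q' = Suc j"
      "\<forall>u v. {u, v} \<in> background (E \<union> B) \<longrightarrow> \<phi> u \<le> \<phi> v + 1"
    by (rule Suc.IH)
  have pV: "p' \<in> V \<union> N" "q' \<in> V \<union> N" using N by auto
  obtain N2 p2 q2 B2 where N2: "finite N2" "N2 \<inter> (V \<union> N) = {}" "card N2 \<le> k"
    "p2 \<in> N2" "q2 \<in> N2" "p2 \<noteq> q2" "attachment (V \<union> N \<union> N2) (E \<union> B \<union> B2)" "B2 \<subseteq> [N2 \<union> {p', q'}]\<^bsup>2\<^esup>"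
    "\<forall>d \<in> B2. \<not> d \<subseteq> V \<union> N" "{p2, q2} \<notin> B2" "forced (E \<union> B \<union> B2) {p2, q2}" "card B2 \<le> h" "finite B2"
    by (rule open_block[OF N(7) pV N(6) p'])
  define \<psi> where "\<psi> v = (if v \<in> N2 then Suc (Suc j) else \<phi> v)" for v
  have new: "p2 \<notin> V \<union> N" "q2 \<notin> V \<union> N" using N2 by auto
  have bgV: "u \<in> V \<union> N \<and> v \<in> V \<union> N" if "{u, v} \<in> background (E \<union> B)" for u v
    using edges_nsetsD[OF background_nsets[OF N(7)] that] by simp
  have "{p2, q2} \<notin> background (E \<union> B)" using bgV new by auto
  then have p2: "{p2, q2} \<notin> background (E \<union> (B \<union> B2))"
    using N2(10) background_Un[of "E \<union> B" B2] by (simp add: Un_assoc)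
  have lip: "\<psi> u \<le> \<psi> v + 1" if "{u, v} \<in> background (E \<union> (B \<union> B2))" for u v
  proof -
    have "{u, v} \<in> B2 \<or> {u, v} \<in> background (E \<union> B)"
      using that background_Un[of "E \<union> B" B2] by (auto simp: Un_assoc)
    then show ?thesis
    proof
      assume "{u, v} \<in> B2"
      then have uv: "u \<in> N2 \<union> {p', q'}" "v \<in> N2 \<union> {p', q'}" using edges_nsetsD[OF N2(8)] by auto
      then have "\<psi> u \<le> Suc (Suc j)" "\<psi> v \<ge> Suc j" unfolding \<psi>_def using phi by auto
      then show ?thesis by simp
    next
      assume bg: "{u, v} \<in> background (E \<union> B)"
      then have "u \<notin> N2" "v \<notin> N2" using bgV[OF bg] N2(2) by auto
      then show ?thesis unfolding \<psi>_def using phi(4) bg by simp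
    qed
  qed
  have dU: "degree (B \<union> B2) v \<le> degree B v + degree B2 v" for v
    using N(8) N2(13) by (rule degree_Un_le)
  have d2: "degree B2 v \<le> h" for v using degree_le_card[OF N2(13), of v] N2(12) by linarith
  have d20: "degree B2 v = 0" if "v \<in> V \<union> N" "v \<noteq> p'" "v \<noteq> q'" for v
    by (rule degree_eq_0[OF N2(8)]) (use that N2(2) in auto)
  have d10: "degree B v = 0" if "v \<in> N2" for v
    by (rule degree_eq_0[OF N(9)]) (use that N2(2) pq in auto)
  have degp: "degree (B \<union> B2) v \<le> h" if "v \<in> {p, q}" for v
  proof -
    have "v \<in> V \<union> N" "v \<noteq> p'" "v \<noteq> q'" using that pq N by auto
    then show ?thesis using dU[of v] d20[of v] that deg by auto
  qed
  have degN2: "degree (B \<union> B2) v \<le> h" if "v \<in> N2" for v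
    using dU[of v] d10[OF that] d2[of v] by linarith
  have degN: "degree (B \<union> B2) v \<le> 2 * h" if "v \<in> N \<union> N2" for v
  proof -
    consider "v \<in> N2" | "v = p' \<or> v = q'" | "v \<in> N" "v \<noteq> p'" "v \<noteq> q'" using \<open>v \<in> N \<union> N2\<close> by blast
    then show ?thesis
    proof cases
      case 1
      then show ?thesis using degN2[of v] by linarith
    next
      case 2
      then show ?thesis using dU[of v] d2[of v] deg(4,5) by auto
    next
      case 3
      then show ?thesis using dU[of v] d20[of v] bspec[OF deg(3), of v] by simp
    qed
  qed
  have card: "card (N \<union> N2) \<le> Suc (Suc j) * k"
    using card_Un_le[of N N2] N(3) N2(3) by simp
  have B12: "B \<union> B2 \<subseteq> [(N \<union> N2) \<union> {p, q}]\<^bsup>2\<^esup>"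
    using N(9) N2(8) N(4,5) nsets_mono[of "N \<union> {p, q}" "(N \<union> N2) \<union> {p, q}" 2]
      nsets_mono[of "N2 \<union> {p', q'}" "(N \<union> N2) \<union> {p, q}" 2] by blast
  show ?case
  proof (rule Suc.prems[of "N \<union> N2" p2 q2 "B \<union> B2" \<psi>])
    show "finite (N \<union> N2)" "(N \<union> N2) \<inter> V = {}" using N N2 by auto
    show "card (N \<union> N2) \<le> Suc (Suc j) * k" by fact
    show "p2 \<in> N \<union> N2" "q2 \<in> N \<union> N2" "p2 \<noteq> q2" using N2 by auto
    show "attachment (V \<union> (N \<union> N2)) (E \<union> (B \<union> B2))" using N2(7) by (simp add: Un_assoc)
    show "finite (B \<union> B2)" using N N2 by simp
    show "B \<union> B2 \<subseteq> [(N \<union> N2) \<union> {p, q}]\<^bsup>2\<^esup>" by fact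
    show "\<forall>d \<in> B \<union> B2. \<not> d \<subseteq> V" using BV N2(9) by blast
    show "{p2, q2} \<notin> background (E \<union> (B \<union> B2))" by fact
    show "forced (E \<union> (B \<union> B2)) {p2, q2}" using N2(11) by (simp add: Un_assoc)
    show "degree (B \<union> B2) p \<le> h" "degree (B \<union> B2) q \<le> h" using degp by auto
    show "\<forall>v \<in> N \<union> N2. degree (B \<union> B2) v \<le> 2 * h" using degN by blast
    show "degree (B \<union> B2) p2 \<le> h" "degree (B \<union> B2) q2 \<le> h" using degN2 N2 by auto
    show "\<forall>v \<in> V. \<psi> v = 0" unfolding \<psi>_def using phi(1) N2(2) by auto
    show "\<psi> p2 = Suc (Suc j)" "\<psi> q2 = Suc (Suc j)" unfolding \<psi>_def using N2 by auto
    show "\<forall>u v. {u, v} \<in> background (E \<union> (B \<union> B2)) \<longrightarrow> \<psi> u \<le> \<psi> v + 1" using lip by blast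
  qed
qed

lemma latent_pair:
  assumes att: "attachment V E"
    and pq: "p \<in> V" "q \<in> V" "p \<noteq> q" "{p, q} \<notin> background E" "forced E {p, q}"
    and xy: "x \<in> V - {p, q}" "y \<in> V - {p, q}" "x \<noteq> y" "{x, y} \<notin> background E"
  obtains N p' q' B where "finite N" "N \<inter> V = {}" "card N \<le> (k + 3) * k"
    "p' \<in> N" "q' \<in> N" "p' \<noteq> q'" "attachment (V \<union> N) (E \<union> B)" "finite B" "B \<subseteq> [N \<union> {p, q, x, y}]\<^bsup>2\<^esup>"
    "\<forall>d \<in> B. \<not> d \<subseteq> V" "{p', q'} \<notin> background (E \<union> B)" "forced (E \<union> B) {p', q'}"
    "forced (E \<union> B) {x, y}" "\<forall>v \<in> {p, q}. degree B v \<le> 2 * h"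
    "\<forall>v \<in> {x, y}. degree B v \<le> h" "\<forall>v \<in> N. degree B v \<le> 3 * h"
    "degree B p' \<le> h" "degree B q' \<le> h"
proof -
  obtain N1 p' q' B1 where N1: "finite N1" "N1 \<inter> V = {}" "card N1 \<le> k"
    "p' \<in> N1" "q' \<in> N1" "p' \<noteq> q'" "attachment (V \<union> N1) (E \<union> B1)" "B1 \<subseteq> [N1 \<union> {p, q}]\<^bsup>2\<^esup>"
    "\<forall>d \<in> B1. \<not> d \<subseteq> V" "{p', q'} \<notin> B1" "forced (E \<union> B1) {p', q'}" "card B1 \<le> h" "finite B1"
    by (rule open_block[OF att pq])
  let ?V1 = "V \<union> N1" and ?E1 = "E \<union> B1"
  have pV1: "p \<in> ?V1" "q \<in> ?V1" using pq by auto
  have pq1: "{p, q} \<notin> background ?E1" using bspec[OF N1(9), of "{p, q}"] pq by (auto simp: background_Un)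
  have f1: "forced ?E1 {p, q}" using pq(5) by (rule forced_mono) auto
  obtain N2 p2 q2 B2 and \<phi> :: "nat \<Rightarrow> nat" where N2: "finite N2" "N2 \<inter> ?V1 = {}" "card N2 \<le> Suc k * k"
    "p2 \<in> N2" "q2 \<in> N2" "p2 \<noteq> q2" "attachment (?V1 \<union> N2) (?E1 \<union> B2)" "finite B2" "B2 \<subseteq> [N2 \<union> {p, q}]\<^bsup>2\<^esup>"
    and B2V: "\<forall>d \<in> B2. \<not> d \<subseteq> ?V1"
    and p2: "{p2, q2} \<notin> background (?E1 \<union> B2)" "forced (?E1 \<union> B2) {p2, q2}"
    and deg: "degree B2 p \<le> h" "degree B2 q \<le> h" "\<forall>v \<in> N2. degree B2 v \<le> 2 * h"
    and phi: "\<forall>v \<in> ?V1. \<phi> v = 0" "\<phi> p2 = Suc k" "\<phi> q2 = Suc k"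
      "\<forall>u v. {u, v} \<in> background (?E1 \<union> B2) \<longrightarrow> \<phi> u \<le> \<phi> v + 1"
    by (rule chain[OF N1(7) pV1 pq(3) pq1 f1, of k])
  let ?V2 = "?V1 \<union> N2" and ?E2 = "?E1 \<union> B2"
  have pV2: "p2 \<in> ?V2" "q2 \<in> ?V2" using N2 by auto
  have WV: "W \<subseteq> V" by (rule attachmentD[OF att])
  have pW: "p2 \<notin> W" "q2 \<notin> W" using WV N2 by auto
  have xV2: "x \<in> ?V2" "y \<in> ?V2" using xy by auto
  have xy2: "{x, y} \<notin> background ?E2"
    using bspec[OF N1(9), of "{x, y}"] bspec[OF B2V, of "{x, y}"] xy by (auto simp: background_Un)
  have ph: "\<phi> x = 0" "\<phi> y = 0" "k \<le> \<phi> p2" "k \<le> \<phi> q2" using bspec[OF phi(1), of x] bspec[OF phi(1), of y] phi(2,3) xy by auto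
  obtain N3 B3 where N3: "finite N3" "N3 \<inter> ?V2 = {}" "card N3 \<le> k"
    "attachment (?V2 \<union> N3) (?E2 \<union> B3)" "B3 \<subseteq> [N3 \<union> {p2, q2, x, y}]\<^bsup>2\<^esup>"
    "\<forall>d \<in> B3. \<not> d \<subseteq> {x, y}"
    "forced (?E2 \<union> B3) {x, y}" "card B3 \<le> h" "finite B3"
    by (rule close_block[OF N2(7) pV2 N2(6) p2 pW xV2 xy(3) xy2 ph phi(4)[rule_format]])
  let ?N = "N1 \<union> N2 \<union> N3" and ?B = "B1 \<union> B2 \<union> B3"
  have dU: "degree ?B v \<le> degree B1 v + degree B2 v + degree B3 v" for v
    using degree_Un_le[of "B1 \<union> B2" B3 v] degree_Un_le[of B1 B2 v] N1(13) N2(8) N3(9) by simp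
  have d1: "degree B1 v \<le> h" for v using degree_le_card[OF N1(13), of v] N1(12) by linarith
  have d3: "degree B3 v \<le> h" for v using degree_le_card[OF N3(9), of v] N3(8) by linarith
  have d10: "degree B1 v = 0" if "v \<notin> N1" "v \<noteq> p" "v \<noteq> q" for v
    by (rule degree_eq_0[OF N1(8)]) (use that in auto)
  have d20: "degree B2 v = 0" if "v \<notin> N2" "v \<noteq> p" "v \<noteq> q" for v
    by (rule degree_eq_0[OF N2(9)]) (use that in auto)
  have d30: "degree B3 v = 0" if "v \<notin> N3" "v \<noteq> p2" "v \<noteq> q2" "v \<noteq> x" "v \<noteq> y" for v
    by (rule degree_eq_0[OF N3(5)]) (use that in auto)
  have disj: "N1 \<inter> V = {}" "N2 \<inter> V = {}" "N2 \<inter> N1 = {}" "N3 \<inter> V = {}" "N3 \<inter> N1 = {}" "N3 \<inter> N2 = {}"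
    using N1(2) N2(2) N3(2) by auto
  have degN1: "degree ?B v \<le> h" if v: "v \<in> N1" for v
  proof -
    have "v \<notin> N2" "v \<notin> N3" "v \<notin> V" using v disj by auto
    moreover from this have "v \<noteq> p" "v \<noteq> q" "v \<noteq> x" "v \<noteq> y" "v \<noteq> p2" "v \<noteq> q2"
      using pq xy N2(4,5) by auto
    ultimately show ?thesis using dU[of v] d1[of v] d20[of v] d30[of v] by simp
  qed
  have p'not: "{p', q'} \<notin> background (E \<union> ?B)"
  proof
    assume "{p', q'} \<in> background (E \<union> ?B)"
    then consider "{p', q'} \<in> B1" | "{p', q'} \<in> B2" | "{p', q'} \<in> B3" | "{p', q'} \<in> background E"
      by (auto simp: background_def)
    then show False
    proof cases
      case 1
      then show ?thesis using N1(10) by simp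
    next
      case 2
      then show ?thesis using bspec[OF B2V, of "{p', q'}"] N1(4,5) by auto
    next
      case 3
      then have "p' \<in> N3 \<union> {p2, q2, x, y}" using edges_nsetsD[OF N3(5)] by auto
      then show ?thesis using N1(4) disj N2(4,5) xy by auto
    next
      case 4
      then have "p' \<in> V" using edges_nsetsD[OF background_nsets[OF att]] by auto
      then show ?thesis using N1(4) disj by auto
    qed
  qed
  show ?thesis
  proof (rule that[of ?N p' q' ?B])
    show "finite ?N" using N1(1) N2(1) N3(1) by simp
    show "?N \<inter> V = {}" using disj by auto
    show "card ?N \<le> (k + 3) * k"
      using card_Un_le[of "N1 \<union> N2" N3] card_Un_le[of N1 N2] N1(3) N2(3) N3(3)
      by (simp add: algebra_simps)
    show "p' \<in> ?N" "q' \<in> ?N" "p' \<noteq> q'" using N1 by auto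
    show "attachment (V \<union> ?N) (E \<union> ?B)" using N3(4) by (simp add: Un_assoc)
    show "finite ?B" using N1(13) N2(8) N3(9) by simp
    show "?B \<subseteq> [?N \<union> {p, q, x, y}]\<^bsup>2\<^esup>"
      using N1(8) N2(9) N3(5) N2(4,5) nsets_mono[of "N1 \<union> {p, q}" "?N \<union> {p, q, x, y}" 2]
        nsets_mono[of "N2 \<union> {p, q}" "?N \<union> {p, q, x, y}" 2]
        nsets_mono[of "N3 \<union> {p2, q2, x, y}" "?N \<union> {p, q, x, y}" 2] by blast
    show "\<forall>d \<in> ?B. \<not> d \<subseteq> V"
    proof
      fix d assume d: "d \<in> ?B"
      consider "d \<in> B1" | "d \<in> B2" | "d \<in> B3" using d by blast
      then show "\<not> d \<subseteq> V"
      proof cases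
        case 1
        then show "\<not> d \<subseteq> V" using N1(9) by blast
      next
        case 2
        then show "\<not> d \<subseteq> V" using bspec[OF B2V, of d] by auto
      next
        case 3
        then have "d \<subseteq> N3 \<union> {p2, q2, x, y}" using N3(5) by (auto simp: nsets_def)
        then show "\<not> d \<subseteq> V" using bspec[OF N3(6) 3] disj N2(4,5) by blast
      qed
    qed
    show "{p', q'} \<notin> background (E \<union> ?B)" by fact
    show "forced (E \<union> ?B) {p', q'}" using N1(11) by (rule forced_mono) auto
    show "forced (E \<union> ?B) {x, y}" using N3(7) by (simp add: Un_assoc)
    show "\<forall>v \<in> {p, q}. degree ?B v \<le> 2 * h"
    proof
      fix v assume v: "v \<in> {p, q}"
      have "v \<notin> N3" "v \<noteq> p2" "v \<noteq> q2" "v \<noteq> x" "v \<noteq> y" using v disj N2(4,5) pq xy by auto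
      then show "degree ?B v \<le> 2 * h" using dU[of v] d1[of v] d30[of v] deg(1,2) v by auto
    qed
    show "\<forall>v \<in> {x, y}. degree ?B v \<le> h"
    proof
      fix v assume v: "v \<in> {x, y}"
      have "v \<notin> N1" "v \<notin> N2" "v \<noteq> p" "v \<noteq> q" using v disj xy by auto
      then show "degree ?B v \<le> h" using dU[of v] d10[of v] d20[of v] d3[of v] by simp
    qed
    show "\<forall>v \<in> ?N. degree ?B v \<le> 3 * h"
    proof
      fix v assume v: "v \<in> ?N"
      consider "v \<in> N1" | "v \<in> N2" | "v \<in> N3" using v by blast
      then show "degree ?B v \<le> 3 * h"
      proof cases
        case 1
        then show "degree ?B v \<le> 3 * h" using degN1[of v] by linarith
      next
        case 2
        then have "v \<notin> N1" "v \<noteq> p" "v \<noteq> q" using disj pq by auto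
        then show "degree ?B v \<le> 3 * h" using dU[of v] d10[of v] bspec[OF deg(3) 2] d3[of v] by linarith
      next
        case 3
        then have "v \<notin> N1" "v \<notin> N2" "v \<noteq> p" "v \<noteq> q" using disj pq by auto
        then show "degree ?B v \<le> 3 * h" using dU[of v] d10[of v] d20[of v] d3[of v] by linarith
      qed
    qed
    show "degree ?B p' \<le> h" "degree ?B q' \<le> h" using degN1 N1(4,5) by auto
  qed
qed

lemma latent_pairs:
  assumes Y: "finite Y" "Y \<inter> W = {}" and PS: "finite PS" "PS \<subseteq> [Y]\<^bsup>2\<^esup>"
  obtains V E p q where "attachment V E" "Y \<subseteq> V" "\<forall>d \<in> E. \<not> d \<subseteq> Y"
    "p \<in> V - Y" "q \<in> V - Y" "p \<noteq> q" "{p, q} \<notin> background E" "forced E {p, q}" "degree E p \<le> h" "degree E q \<le> h"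
    "\<forall>d \<in> PS. forced E d" "\<forall>v \<in> V - Y. degree E v \<le> 3 * h"
    "\<forall>v \<in> Y. degree E v \<le> h * card {d \<in> PS. v \<in> d}"
    "card V \<le> card W + card Y + card PS * ((k + 3) * k)"
  using PS
proof (induction PS arbitrary: thesis rule: finite_induct)
  case empty
  have bg: "background {} \<subseteq> [W]\<^bsup>2\<^esup>" unfolding background_def by auto
  have "sparse W (background {})"
    unfolding sparse_def using three_connected_subset[OF _ bg] by blast
  then have att: "attachment (W \<union> Y) {}" unfolding attachment_def using finW Y by auto
  have deg: "degree {} v = 0" for v :: nat unfolding degree_def by simp
  show ?case
  proof (rule empty.prems(1)[of "W \<union> Y" "{}" a b])
    show "forced {} {a, b}" unfolding forced_def by blast
    show "{a, b} \<notin> background {}" unfolding background_def by auto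
    show "card (W \<union> Y) \<le> card W + card Y + card {} * ((k + 3) * k)" using card_Un_le[of W Y] by simp
  qed (use att deg ab Y in auto)
next
  case (insert d F)
  then have "F \<subseteq> [Y]\<^bsup>2\<^esup>" by simp
  then obtain V E p q where IH: "attachment V E" "Y \<subseteq> V" "\<forall>d \<in> E. \<not> d \<subseteq> Y"
    "p \<in> V - Y" "q \<in> V - Y" "p \<noteq> q" "{p, q} \<notin> background E" "forced E {p, q}" "degree E p \<le> h" "degree E q \<le> h"
    "\<forall>d \<in> F. forced E d" "\<forall>v \<in> V - Y. degree E v \<le> 3 * h"
    "\<forall>v \<in> Y. degree E v \<le> h * card {d \<in> F. v \<in> d}"
    "card V \<le> card W + card Y + card F * ((k + 3) * k)"
    using insert.IH by blast
  have "d \<in> [Y]\<^bsup>2\<^esup>" using insert.prems(2) by simp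
  then obtain x y where xy: "d = {x, y}" "x \<in> Y" "y \<in> Y" "x \<noteq> y" using nsets2_E by metis
  have pqV: "p \<in> V" "q \<in> V" using IH(4,5) by auto
  have xV: "x \<in> V - {p, q}" "y \<in> V - {p, q}" using xy IH(2,4,5) by auto
  have xyn: "{x, y} \<notin> background E"
    unfolding background_def using bspec[OF IH(3), of "{x, y}"] xy Y by auto
  obtain N p' q' B where N: "finite N" "N \<inter> V = {}" "card N \<le> (k + 3) * k"
    "p' \<in> N" "q' \<in> N" "p' \<noteq> q'" "attachment (V \<union> N) (E \<union> B)" "finite B" "B \<subseteq> [N \<union> {p, q, x, y}]\<^bsup>2\<^esup>"
    "\<forall>d \<in> B. \<not> d \<subseteq> V" "{p', q'} \<notin> background (E \<union> B)" "forced (E \<union> B) {p', q'}"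
    "forced (E \<union> B) {x, y}" "\<forall>v \<in> {p, q}. degree B v \<le> 2 * h"
    "\<forall>v \<in> {x, y}. degree B v \<le> h" "\<forall>v \<in> N. degree B v \<le> 3 * h"
    "degree B p' \<le> h" "degree B q' \<le> h"
    by (rule latent_pair[OF IH(1) pqV IH(6-8) xV xy(4) xyn])
  have dU: "degree (E \<union> B) v \<le> degree E v + degree B v" for v
    using attachment_finite_edges[OF IH(1)] N(8) by (rule degree_Un_le)
  have dE0: "degree E v = 0" if "v \<in> N" for v
    by (rule degree_eq_0[OF attachmentD(3)[OF IH(1)]]) (use that N(2) in auto)
  have dB0: "degree B v = 0" if "v \<in> V" "v \<notin> {p, q, x, y}" for v
    by (rule degree_eq_0[OF N(9)]) (use that N(2) in auto)
  have cardF: "card {e \<in> insert d F. v \<in> e} = (if v \<in> d then 1 else 0) + card {e \<in> F. v \<in> e}" for v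
  proof -
    have "{e \<in> insert d F. v \<in> e} = (if v \<in> d then insert d {e \<in> F. v \<in> e} else {e \<in> F. v \<in> e})" by auto
    then show ?thesis using insert.hyps by simp
  qed
  show ?case
  proof (rule insert.prems(1)[of "V \<union> N" "E \<union> B" p' q'])
    show "attachment (V \<union> N) (E \<union> B)" by (rule N)
    show "Y \<subseteq> V \<union> N" using IH(2) by auto
    show "\<forall>e \<in> E \<union> B. \<not> e \<subseteq> Y" using IH(2,3) N(10) by blast
    show "p' \<in> V \<union> N - Y" "q' \<in> V \<union> N - Y" "p' \<noteq> q'" using N(2,4-6) IH(2) by auto
    show "{p', q'} \<notin> background (E \<union> B)" "forced (E \<union> B) {p', q'}" by (rule N)+
    show "degree (E \<union> B) p' \<le> h" "degree (E \<union> B) q' \<le> h"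
      using dU[of p'] dU[of q'] dE0 N(4,5,17,18) by auto
    show "\<forall>e \<in> insert d F. forced (E \<union> B) e" using forced_mono[OF bspec[OF IH(11)]] N(13) xy(1) by auto
    show "\<forall>v \<in> V \<union> N - Y. degree (E \<union> B) v \<le> 3 * h"
    proof
      fix v assume v: "v \<in> V \<union> N - Y"
      consider "v \<in> N" | "v \<in> {p, q}" | "v \<in> V - Y" "v \<notin> {p, q, x, y}" using v xy by blast
      then show "degree (E \<union> B) v \<le> 3 * h"
      proof cases
        case 1
        then show ?thesis using dU[of v] dE0[of v] bspec[OF N(16), of v] by simp
      next
        case 2
        then show ?thesis using dU[of v] IH(9,10) bspec[OF N(14) 2] by auto
      next
        case 3
        then show ?thesis using dU[of v] dB0[of v] bspec[OF IH(12), of v] by simp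
      qed
    qed
    show "\<forall>v \<in> Y. degree (E \<union> B) v \<le> h * card {e \<in> insert d F. v \<in> e}"
    proof
      fix v assume v: "v \<in> Y"
      show "degree (E \<union> B) v \<le> h * card {e \<in> insert d F. v \<in> e}"
      proof (cases "v \<in> {x, y}")
        case True
        then show ?thesis using dU[of v] bspec[OF IH(13) v] bspec[OF N(15) True] xy(1) unfolding cardF by auto
      next
        case False
        then have "v \<notin> {p, q, x, y}" using v IH(4,5) by auto
        then show ?thesis using dU[of v] bspec[OF IH(13) v] dB0[of v] v IH(2) False xy(1) unfolding cardF by auto
      qed
    qed
    show "card (V \<union> N) \<le> card W + card Y + card (insert d F) * ((k + 3) * k)"
      using card_Un_le[of V N] IH(14) N(3) insert.hyps by simp
  qed
qed

lemma absorb: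
  assumes S: "\<forall>d \<in> [S]\<^bsup>2\<^esup>. forced E d" and T: "T \<subseteq> S" "card T = k - 2" "\<forall>t \<in> T. forced E {v, t}"
    and v: "v \<notin> S"
  shows "\<forall>d \<in> [insert v S]\<^bsup>2\<^esup>. forced E d"
proof
  fix d assume d: "d \<in> [insert v S]\<^bsup>2\<^esup>"
  have finT: "finite T" using T k_ge_5 by (intro card_ge_0_finite) simp
  show "forced E d"
  proof (cases "v \<in> d")
    case False
    then have "d \<in> [S]\<^bsup>2\<^esup>" using d by (auto simp: nsets_def)
    then show ?thesis using S by blast
  next
    case True
    then obtain s where s: "d = {v, s}" "s \<in> S" "s \<noteq> v" using d v by (auto elim!: nsets2_E)
    show ?thesis
    proof (cases "s \<in> T")
      case True
      then show ?thesis using s T by auto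
    next
      case False
      show ?thesis
        unfolding forced_def
      proof (intro allI impI)
        fix Z assume Z: "percolation_closed H Z" "insert {a, b} E \<subseteq> Z"
        have SZ: "{x, y} \<in> Z" if "x \<in> S" "y \<in> S" "x \<noteq> y" for x y
        proof -
          have "{x, y} \<in> [S]\<^bsup>2\<^esup>" using that by simp
          then show ?thesis using S Z unfolding forced_def by blast
        qed
        have TZ: "{v, t} \<in> Z" if "t \<in> T" for t using T(3) that Z unfolding forced_def by blast
        obtain e1 e2 f1 f2 where ef: "{e1, e2} \<in> edges H" "{f1, f2} \<in> edges H"
          "distinct [e1, e2, f1, f2]" "{e1, e2, f1, f2} \<subseteq> verts H" by (rule disjoint_edges)
        define A where "A = verts H - {e1, e2}"
        have "card A = k - 2" unfolding A_def using ef finV by (subst card_Diff_subset) auto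
        then obtain g0 where g0: "bij_betw g0 A T"
          using finite_same_card_bij[of A T] finT T(2) finV unfolding A_def by auto
        define g where "g x = (if x = e1 then v else if x = e2 then s else g0 x)" for x
        have gA: "g x \<in> T" if "x \<in> A" for x
          using that bij_betwE[OF g0] unfolding g_def A_def by auto
        have g_e: "g e1 = v" "g e2 = s" unfolding g_def using ef by auto
        have HA: "verts H = {e1, e2} \<union> A" unfolding A_def using ef by auto
        have inj: "inj_on g (verts H)"
          unfolding HA
        proof (rule inj_on_Un[THEN iffD2], intro conjI)
          show "inj_on g {e1, e2}" using g_e s by (auto simp: inj_on_def)
          have "\<forall>v \<in> A. g v = g0 v" unfolding A_def g_def by auto
          then show "inj_on g A" using g0 by (simp add: inj_on_def bij_betw_def)
          show "g ` ({e1, e2} - A) \<inter> g ` (A - {e1, e2}) = {}"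
          proof -
            have "g ` ({e1, e2} - A) \<subseteq> {v, s}" "g ` (A - {e1, e2}) \<subseteq> T" using gA g_e by auto
            moreover have "v \<notin> T" using v T(1) by auto
            ultimately show ?thesis using False by blast
          qed
        qed
        have "g ` d' \<in> Z" if d': "d' \<in> edges H - {{e1, e2}}" for d'
        proof -
          have "d' \<in> edges H" using d' by simp
          then obtain x y where xy: "d' = {x, y}" "x \<in> verts H" "y \<in> verts H" "x \<noteq> y"
            using nsets2_memE[OF _ EH] by metis
          have img: "g ` d' = {g x, g y}" and ne: "g x \<noteq> g y" using xy inj by (auto dest: inj_onD)
          have inS: "g z \<in> S" if "z \<in> verts H" "z \<noteq> e1" for z
            using that gA[of z] g_e s(2) T(1) unfolding HA by auto
          have inT: "g z \<in> T" if "z \<in> verts H" "z \<noteq> e1" "z \<noteq> e2" for z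
            using that gA[of z] unfolding HA by auto
          consider "x = e1" | "y = e1" | "x \<noteq> e1" "y \<noteq> e1" by blast
          then show ?thesis
          proof cases
            case 1
            then have "y \<noteq> e1" "y \<noteq> e2" using xy d' by auto
            then show ?thesis using TZ[OF inT[OF xy(3)]] g_e 1 img by simp
          next
            case 2
            then have "x \<noteq> e1" "x \<noteq> e2" using xy d' by (auto simp: insert_commute)
            then show ?thesis using TZ[OF inT[OF xy(2)]] g_e 2 img by (simp add: insert_commute)
          next
            case 3
            then show ?thesis using SZ[OF inS[OF xy(2)] inS[OF xy(3)] ne] img by simp
          qed
        qed
        then have "completes H Z (g ` {e1, e2}) g {e1, e2}" unfolding completes_def using inj ef(1) by blast
        then have "g ` {e1, e2} \<in> Z" using Z(1) unfolding percolation_closed_def by blast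
        then show "d \<in> Z" using g_e s by simp
      qed
    qed
  qed
qed

lemma band_forced:
  assumes band: "\<And>i j. m \<le> i \<Longrightarrow> i < j \<Longrightarrow> j \<le> i + k \<Longrightarrow> j < m + R \<Longrightarrow> forced E {i, j}"
  shows "n \<le> R \<Longrightarrow> \<forall>d \<in> [{m..<m + n}]\<^bsup>2\<^esup>. forced E d"
proof (induction n)
  case 0
  show ?case by (simp add: nsets_eq_empty)
next
  case (Suc n)
  have eq: "{m..<m + Suc n} = insert (m + n) {m..<m + n}" by auto
  show ?case
  proof (cases "k - 2 \<le> n")
    case True
    let ?T = "{m + n - (k - 2)..<m + n}"
    show ?thesis
      unfolding eq
    proof (rule absorb[of _ _ ?T])
      show "\<forall>d \<in> [{m..<m + n}]\<^bsup>2\<^esup>. forced E d" using Suc by simp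
      show "\<forall>t \<in> ?T. forced E {m + n, t}"
      proof
        fix t assume "t \<in> ?T"
        then have "forced E {t, m + n}" using True Suc.prems by (intro band) auto
        then show "forced E {m + n, t}" by (simp add: insert_commute)
      qed
    qed (use True in auto)
  next
    case False
    show ?thesis
    proof
      fix d assume "d \<in> [{m..<m + Suc n}]\<^bsup>2\<^esup>"
      then obtain i j where ij: "d = {i, j}" "i \<in> {m..<m + Suc n}" "j \<in> {m..<m + Suc n}" "i \<noteq> j"
        by (rule nsets2_E)
      have "forced E {min i j, max i j}" using ij False Suc.prems by (intro band) auto
      moreover have "{min i j, max i j} = d" unfolding ij(1) by (auto simp: min_def max_def)
      ultimately show "forced E d" by simp
    qed
  qed
qed

lemma far_edge:
  assumes att: "attachment V E" and v: "v \<in> V" and L: "L \<subseteq> V" "L \<inter> W = {}"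
    and deg: "\<forall>u \<in> V. degree E u \<le> \<Delta>"
    and card: "(card W + 1) * (1 + 2 * \<Delta>) ^ k < card L"
  obtains s where "s \<in> L" "s \<noteq> v" "{v, s} \<notin> E" "attachment V (insert {v, s} E)"
proof -
  note A = attachmentD[OF att]
  let ?U = "insert v W"
  have finU: "finite ?U" using finW by simp
  have deg': "degree E u \<le> \<Delta>" for u
    using deg degree_eq_0[OF A(3), of u] by (cases "u \<in> V") auto
  have ball: "finite (edge_ball E ?U k)" "card (edge_ball E ?U k) \<le> card ?U * (1 + 2 * \<Delta>) ^ k"
    using edge_ball_finite_card[OF A(3) A(1) finU deg', of k] by auto
  have "card ?U \<le> card W + 1" using finW by (simp add: card_insert_if)
  then have "card ?U * (1 + 2 * \<Delta>) ^ k \<le> (card W + 1) * (1 + 2 * \<Delta>) ^ k" by (rule mult_right_mono) simp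
  then have "card (edge_ball E ?U k) < card L" using ball(2) card by linarith
  then have "\<not> L \<subseteq> edge_ball E ?U k" using card_mono[OF ball(1)] by (meson leD)
  then obtain s where s: "s \<in> L" "s \<notin> edge_ball E ?U k" by blast
  have s_i: "s \<notin> edge_ball E ?U i" if "i \<le> k" for i using s(2) edge_ball_mono[OF that, of E ?U] by blast
  have sv: "s \<noteq> v" using s_i[of 0] by auto
  have "{v, s} \<notin> E"
  proof
    assume "{v, s} \<in> E"
    then have "s \<in> edge_ball E ?U (Suc 0)" by (intro edge_ball_step[of v]) (auto simp: insert_commute)
    then show False using s_i[of "Suc 0"] k_ge_5 by simp
  qed
  define \<phi> where "\<phi> u = card {i. i < k \<and> u \<notin> edge_ball E ?U i}" for u
  have ball0: "u \<in> edge_ball E ?U i" if "u \<in> ?U" for u i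
    using edge_ball_mono[of 0 i E ?U] that by auto
  have "\<phi> v = 0" unfolding \<phi>_def using ball0[of v] by simp
  moreover have "{i. i < k \<and> s \<notin> edge_ball E ?U i} = {..<k}" using s_i by auto
  then have "k \<le> \<phi> s" unfolding \<phi>_def by simp
  moreover have "\<phi> x \<le> \<phi> y + 1" if xy: "{x, y} \<in> background E" for x y
  proof -
    have "{i. i < k \<and> x \<notin> edge_ball E ?U i} \<subseteq> insert 0 (Suc ` {i. i < k \<and> y \<notin> edge_ball E ?U i})"
    proof
      fix i assume "i \<in> {i. i < k \<and> x \<notin> edge_ball E ?U i}"
      then have i: "i < k" "x \<notin> edge_ball E ?U i" by auto
      show "i \<in> insert 0 (Suc ` {i. i < k \<and> y \<notin> edge_ball E ?U i})"
      proof (cases i)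
        case (Suc i')
        have "{x, y} \<in> E" using xy ball0[of x i] i(2) unfolding background_def by auto
        then have "y \<notin> edge_ball E ?U i'" using edge_ball_step i(2) Suc by metis
        then show ?thesis using Suc i(1) by auto
      qed simp
    qed
    then have "\<phi> x \<le> card (insert 0 (Suc ` {i. i < k \<and> y \<notin> edge_ball E ?U i}))"
      unfolding \<phi>_def by (intro card_mono) auto
    also have "\<dots> \<le> Suc (card (Suc ` {i. i < k \<and> y \<notin> edge_ball E ?U i}))" by (rule card_insert_le_m1) auto
    also have "\<dots> \<le> \<phi> y + 1" unfolding \<phi>_def by (simp add: card_image)
    finally show ?thesis .
  qed
  ultimately have "sparse W (insert {v, s} (background E))"
    using s(1) L(1) sv v by (intro sparse_insert_edge[OF background_nsets[OF att] v _ _ _ _ _ A(5)]) auto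
  then have "sparse W (background (insert {v, s} E))" unfolding background_def by simp
  moreover have "\<not> {v, s} \<subseteq> W" using s(1) L(2) by auto
  moreover have "{v, s} \<in> [V]\<^bsup>2\<^esup>" using v s(1) L(1) sv by auto
  ultimately have "attachment V (insert {v, s} E)" unfolding attachment_def using A by auto
  then show ?thesis using that s(1) sv \<open>{v, s} \<notin> E\<close> by blast
qed

lemma attach_vertex:
  assumes att: "attachment V E" and Y: "Y \<subseteq> V" "Y \<inter> W = {}" and v: "v \<in> V - Y"
    and degV: "\<forall>u \<in> V. degree E u \<le> \<Delta>"
    and M: "2 * M \<le> card Y * \<Delta>" "2 * (card W + 1) * (1 + 2 * \<Delta>) ^ k < card Y"
    and degv: "degree E v + j \<le> \<Delta>" and sum: "(\<Sum>s \<in> Y. degree E s) + j \<le> M" and pos: "0 < \<Delta>"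
  obtains E' T where "attachment V E'" "E \<subseteq> E'" "\<forall>u \<in> V. degree E' u \<le> \<Delta>"
    "(\<Sum>s \<in> Y. degree E' s) \<le> (\<Sum>s \<in> Y. degree E s) + j" "degree E' v \<le> degree E v + j"
    "\<forall>u \<in> V - Y - {v}. degree E' u = degree E u"
    "T \<subseteq> Y" "card T = j" "\<forall>t \<in> T. {v, t} \<in> E'"
  using degv sum
proof (induction j arbitrary: thesis)
  case 0
  show ?case by (rule "0.prems"(1)[of E "{}"]) (use att degV in auto)
next
  case (Suc j)
  have finY: "finite Y" using Y(1) attachmentD(1)[OF att] finite_subset by blast
  have "degree E v + j \<le> \<Delta>" "(\<Sum>s \<in> Y. degree E s) + j \<le> M" using Suc.prems(2,3) by auto
  then obtain E1 T where E1: "attachment V E1" "E \<subseteq> E1" "\<forall>u \<in> V. degree E1 u \<le> \<Delta>"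
    "(\<Sum>s \<in> Y. degree E1 s) \<le> (\<Sum>s \<in> Y. degree E s) + j" "degree E1 v \<le> degree E v + j"
    "\<forall>u \<in> V - Y - {v}. degree E1 u = degree E u"
    "T \<subseteq> Y" "card T = j" "\<forall>t \<in> T. {v, t} \<in> E1"
    using Suc.IH by metis
  define L where "L = {s \<in> Y. degree E1 s < \<Delta>}"
  have "card (Y - L) * \<Delta> = (\<Sum>s \<in> Y - L. \<Delta>)" by simp
  also have "\<dots> \<le> (\<Sum>s \<in> Y - L. degree E1 s)" by (rule sum_mono) (auto simp: L_def)
  also have "\<dots> \<le> (\<Sum>s \<in> Y. degree E1 s)" using finY by (intro sum_mono2) auto
  also have "\<dots> \<le> M" using E1(4) Suc.prems(3) by linarith
  finally have "2 * card (Y - L) * \<Delta> \<le> card Y * \<Delta>" using M(1) by linarith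
  then have "2 * card (Y - L) \<le> card Y" using pos by simp
  moreover have "card Y = card L + card (Y - L)"
    using card_Un_disjoint[of L "Y - L"] finY unfolding L_def
    by (metis (no_types, lifting) Diff_disjoint Diff_partition finite_Diff finite_subset mem_Collect_eq subsetI)
  ultimately have big: "(card W + 1) * (1 + 2 * \<Delta>) ^ k < card L" using M(2) by linarith
  have L: "L \<subseteq> V" "L \<inter> W = {}" using Y unfolding L_def by auto
  have vV: "v \<in> V" using v by simp
  obtain s where s: "s \<in> L" "s \<noteq> v" "{v, s} \<notin> E1" "attachment V (insert {v, s} E1)"
    by (rule far_edge[OF E1(1) vV L E1(3) big])
  let ?E2 = "insert {v, s} E1"
  have deg: "degree ?E2 u = degree E1 u + (if u \<in> {v, s} then 1 else 0)" for u
    using attachment_finite_edges[OF E1(1)] s(3) by (rule degree_insert)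
  have sY: "s \<in> Y" "degree E1 s < \<Delta>" using s(1) unfolding L_def by auto
  have "(\<Sum>u \<in> Y. degree ?E2 u) = (\<Sum>u \<in> Y. degree E1 u) + (\<Sum>u \<in> Y. if u = s then 1 else 0)"
    unfolding sum.distrib[symmetric] by (rule sum.cong) (use v in \<open>auto simp: deg\<close>)
  then have sum2: "(\<Sum>u \<in> Y. degree ?E2 u) = (\<Sum>u \<in> Y. degree E1 u) + 1" using finY sY by simp
  show ?case
  proof (rule Suc.prems(1)[of ?E2 "insert s T"])
    show "attachment V ?E2" by (rule s)
    show "E \<subseteq> ?E2" using E1(2) by auto
    show "\<forall>u \<in> V. degree ?E2 u \<le> \<Delta>" using deg E1(3,5) sY(2) Suc.prems(2) by auto
    show "(\<Sum>u \<in> Y. degree ?E2 u) \<le> (\<Sum>s \<in> Y. degree E s) + Suc j" using sum2 E1(4) by simp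
    show "degree ?E2 v \<le> degree E v + Suc j" using deg[of v] E1(5) by simp
    show "\<forall>u \<in> V - Y - {v}. degree ?E2 u = degree E u" using deg E1(6) sY by auto
    show "insert s T \<subseteq> Y" using E1(7) sY by simp
    have "s \<notin> T" using s(3) E1(9) by auto
    moreover have "finite T" using E1(7) finY finite_subset by blast
    ultimately show "card (insert s T) = Suc j" using E1(8) by simp
    show "\<forall>t \<in> insert s T. {v, t} \<in> ?E2" using E1(9) by auto
  qed
qed

lemma attach_vertices:
  assumes att: "attachment V E" and Y: "Y \<subseteq> V" "Y \<inter> W = {}"
    and degV: "\<forall>u \<in> V. degree E u \<le> \<Delta>" and degN: "\<forall>u \<in> V - Y. degree E u + j \<le> \<Delta>"
    and M: "2 * M \<le> card Y * \<Delta>" "2 * (card W + 1) * (1 + 2 * \<Delta>) ^ k < card Y" and pos: "0 < \<Delta>"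
    and Z: "finite Z" "Z \<subseteq> V - Y" and sum: "(\<Sum>s \<in> Y. degree E s) + card Z * j \<le> M"
  obtains E' where "attachment V E'" "E \<subseteq> E'" "\<forall>u \<in> V. degree E' u \<le> \<Delta>"
    "(\<Sum>s \<in> Y. degree E' s) \<le> (\<Sum>s \<in> Y. degree E s) + card Z * j"
    "\<forall>u \<in> V - Y - Z. degree E' u = degree E u"
    "\<forall>v \<in> Z. \<exists>T \<subseteq> Y. card T = j \<and> (\<forall>t \<in> T. {v, t} \<in> E')"
  using Z sum
proof (induction Z arbitrary: thesis rule: finite_induct)
  case empty
  show ?case by (rule empty.prems(1)[of E]) (use att degV in auto)
next
  case (insert z Z)
  have z: "z \<in> V - Y" and ZV: "Z \<subseteq> V - Y" using insert.prems(2) by auto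
  have cz: "card (insert z Z) * j = card Z * j + j" using insert.hyps by simp
  have "(\<Sum>s \<in> Y. degree E s) + card Z * j \<le> M" using insert.prems(3) cz by linarith
  then obtain E1 where E1: "attachment V E1" "E \<subseteq> E1" "\<forall>u \<in> V. degree E1 u \<le> \<Delta>"
    "(\<Sum>s \<in> Y. degree E1 s) \<le> (\<Sum>s \<in> Y. degree E s) + card Z * j"
    "\<forall>u \<in> V - Y - Z. degree E1 u = degree E u"
    "\<forall>v \<in> Z. \<exists>T \<subseteq> Y. card T = j \<and> (\<forall>t \<in> T. {v, t} \<in> E1)"
    using insert.IH ZV by metis
  have degz: "degree E1 z + j \<le> \<Delta>" using E1(5) degN z insert.hyps(2) by simp
  have sumz: "(\<Sum>s \<in> Y. degree E1 s) + j \<le> M" using E1(4) insert.prems(3) cz by linarith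
  obtain E2 T where E2: "attachment V E2" "E1 \<subseteq> E2" "\<forall>u \<in> V. degree E2 u \<le> \<Delta>"
    "(\<Sum>s \<in> Y. degree E2 s) \<le> (\<Sum>s \<in> Y. degree E1 s) + j" "degree E2 z \<le> degree E1 z + j"
    "\<forall>u \<in> V - Y - {z}. degree E2 u = degree E1 u"
    "T \<subseteq> Y" "card T = j" "\<forall>t \<in> T. {z, t} \<in> E2"
    by (rule attach_vertex[OF E1(1) Y z E1(3) M degz sumz pos])
  show ?case
  proof (rule insert.prems(1)[of E2])
    show "attachment V E2" "\<forall>u \<in> V. degree E2 u \<le> \<Delta>" by (rule E2)+
    show "E \<subseteq> E2" using E1(2) E2(2) by auto
    show "(\<Sum>s \<in> Y. degree E2 s) \<le> (\<Sum>s \<in> Y. degree E s) + card (insert z Z) * j"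
      using E2(4) E1(4) cz by linarith
    show "\<forall>u \<in> V - Y - insert z Z. degree E2 u = degree E u" using E1(5) E2(6) by simp
    show "\<forall>v \<in> insert z Z. \<exists>T \<subseteq> Y. card T = j \<and> (\<forall>t \<in> T. {v, t} \<in> E2)"
    proof
      fix v assume "v \<in> insert z Z"
      then consider "v = z" | "v \<in> Z" by blast
      then show "\<exists>T \<subseteq> Y. card T = j \<and> (\<forall>t \<in> T. {v, t} \<in> E2)"
      proof cases
        case 1
        then show ?thesis using E2(7-9) by blast
      next
        case 2
        then obtain T' where "T' \<subseteq> Y" "card T' = j" "\<forall>t \<in> T'. {v, t} \<in> E1" using E1(6) by blast
        then show ?thesis using E2(2) by blast
      qed
    qed
  qed
qed

lemma forced_complete:
  assumes Y: "\<forall>d \<in> [Y]\<^bsup>2\<^esup>. forced E d"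
    and Z: "finite Z" "Z \<inter> Y = {}" "\<forall>v \<in> Z. \<exists>T \<subseteq> Y. card T = k - 2 \<and> (\<forall>t \<in> T. {v, t} \<in> E)"
  shows "\<forall>d \<in> [Y \<union> Z]\<^bsup>2\<^esup>. forced E d"
  using Z
proof (induction Z rule: finite_induct)
  case empty
  then show ?case using Y by simp
next
  case (insert z Z)
  then have IH: "\<forall>d \<in> [Y \<union> Z]\<^bsup>2\<^esup>. forced E d" by simp
  obtain T where T: "T \<subseteq> Y" "card T = k - 2" "\<forall>t \<in> T. {z, t} \<in> E" using insert.prems(2) by auto
  have "\<forall>t \<in> T. forced E {z, t}" using T(3) unfolding forced_def by blast
  then have "\<forall>d \<in> [insert z (Y \<union> Z)]\<^bsup>2\<^esup>. forced E d"
    using T insert by (intro absorb[OF IH, of T]) auto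
  then show ?case by simp
qed

lemma percolating_attachment:
  obtains V E where "attachment V E" "\<forall>d \<in> [V]\<^bsup>2\<^esup>. forced E d"
    "card V \<le> card W + clique_size (card W) * (1 + latent_cost)"
proof -
  define R where "R = clique_size (card W)"
  define m where "m = Suc (Max W)"
  define Y where "Y = {m..<m + R}"
  define PS where "PS = {d. \<exists>i j. d = {i, j} \<and> m \<le> i \<and> i < j \<and> j \<le> i + k \<and> j < m + R}"
  have finY: "finite Y" and cardY: "card Y = R" unfolding Y_def by auto
  have YW: "Y \<inter> W = {}"
    unfolding Y_def m_def using Max_ge[OF finW] by (fastforce simp: Suc_le_eq)
  have PSY: "PS \<subseteq> [Y]\<^bsup>2\<^esup>" unfolding PS_def Y_def by auto
  then have finPS: "finite PS" using finY finite_edges by blast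
  have "PS \<subseteq> (\<lambda>(i, t). {i, i + t}) ` (Y \<times> {..k})"
  proof
    fix d assume "d \<in> PS"
    then obtain i j where "d = {i, j}" "m \<le> i" "i < j" "j \<le> i + k" "j < m + R" unfolding PS_def by blast
    then show "d \<in> (\<lambda>(i, t). {i, i + t}) ` (Y \<times> {..k})"
      by (intro image_eqI[of _ _ "(i, j - i)"]) (auto simp: Y_def)
  qed
  then have "card PS \<le> card ((\<lambda>(i, t). {i, i + t}) ` (Y \<times> {..k}))" using finY by (intro card_mono) auto
  also have "\<dots> \<le> card (Y \<times> {..k})" using finY by (intro card_image_le) auto
  finally have cardPS: "card PS \<le> R * (k + 1)" using cardY by (simp add: card_cartesian_product)
  have degPS: "card {d \<in> PS. v \<in> d} \<le> 2 * k + 1" for v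
  proof -
    have "{d \<in> PS. v \<in> d} \<subseteq> (\<lambda>u. {u, v}) ` {v - k..v + k}"
    proof
      fix d assume "d \<in> {d \<in> PS. v \<in> d}"
      then obtain i j where ij: "d = {i, j}" "i < j" "j \<le> i + k" "v \<in> {i, j}" unfolding PS_def by blast
      then show "d \<in> (\<lambda>u. {u, v}) ` {v - k..v + k}"
        by (cases "v = i") (auto intro!: image_eqI[of _ _ "if v = i then j else i"] simp: insert_commute)
    qed
    then have "card {d \<in> PS. v \<in> d} \<le> card ((\<lambda>u. {u, v}) ` {v - k..v + k})" by (intro card_mono) auto
    also have "\<dots> \<le> card {v - k..v + k}" by (intro card_image_le) auto
    also have "\<dots> \<le> 2 * k + 1" by simp
    finally show ?thesis .
  qed
  obtain V E p q where VE: "attachment V E" "Y \<subseteq> V" "\<forall>d \<in> E. \<not> d \<subseteq> Y"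
    "p \<in> V - Y" "q \<in> V - Y" "p \<noteq> q" "{p, q} \<notin> background E" "forced E {p, q}" "degree E p \<le> h" "degree E q \<le> h"
    "\<forall>d \<in> PS. forced E d" "\<forall>v \<in> V - Y. degree E v \<le> 3 * h"
    "\<forall>v \<in> Y. degree E v \<le> h * card {d \<in> PS. v \<in> d}"
    "card V \<le> card W + card Y + card PS * ((k + 3) * k)"
    by (rule latent_pairs[OF finY YW finPS PSY])
  have finV': "finite V" using VE(1) by (rule attachmentD)
  have "card PS * ((k + 3) * k) \<le> R * (k + 1) * ((k + 3) * k)" using cardPS by (rule mult_right_mono) simp
  also have "\<dots> = R * latent_cost" unfolding latent_cost_def by (simp add: algebra_simps)
  finally have cardV: "card V \<le> card W + R + R * latent_cost" using VE(14) cardY by linarith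
  have degY: "degree E v \<le> h * (2 * k + 1)" if "v \<in> Y" for v
    using bspec[OF VE(13) that] mult_left_mono[OF degPS[of v], of h] by linarith
  define M where "M = R * (h * (2 * k + 1) + k * (1 + latent_cost))"
  have WR: "card W \<le> R" unfolding R_def by (rule clique_size_ge)
  have "card (V - Y) = card V - R" using VE(2) finY cardY by (simp add: card_Diff_subset)
  then have "card (V - Y) \<le> R * (1 + latent_cost)" using cardV WR by (simp add: algebra_simps)
  then have "card (V - Y) * (k - 2) \<le> R * (1 + latent_cost) * k" by (intro mult_mono) auto
  moreover have "(\<Sum>s \<in> Y. degree E s) \<le> R * (h * (2 * k + 1))"
    using sum_bounded_above[of Y "degree E" "h * (2 * k + 1)"] degY cardY by simp
  ultimately have sum: "(\<Sum>s \<in> Y. degree E s) + card (V - Y) * (k - 2) \<le> M"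
    unfolding M_def by (simp add: algebra_simps)
  have M2: "2 * M \<le> card Y * degree_cap" unfolding M_def cardY degree_cap_def by (simp add: algebra_simps)
  have big: "2 * (card W + 1) * (1 + 2 * degree_cap) ^ k < card Y"
    unfolding cardY R_def clique_size_def by simp
  have pos: "0 < degree_cap" unfolding degree_cap_def using k_ge_5 by simp
  have degN: "\<forall>u \<in> V - Y. degree E u + (k - 2) \<le> degree_cap"
  proof
    fix u assume "u \<in> V - Y"
    with VE(12) have "degree E u \<le> 3 * h" by blast
    then show "degree E u + (k - 2) \<le> degree_cap" unfolding degree_cap_def by linarith
  qed
  have degV: "\<forall>u \<in> V. degree E u \<le> degree_cap"
  proof
    fix u assume "u \<in> V"
    show "degree E u \<le> degree_cap"
    proof (cases "u \<in> Y")
      case True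
      moreover have "h * (2 * k + 1) \<le> degree_cap"
        unfolding degree_cap_def mult_2[of "_ + _"] by (intro trans_le_add1) simp
      ultimately show ?thesis using degY[of u] by linarith
    next
      case False
      then have "degree E u + (k - 2) \<le> degree_cap" using degN \<open>u \<in> V\<close> by blast
      then show ?thesis by linarith
    qed
  qed
  obtain E' where E': "attachment V E'" "E \<subseteq> E'" "\<forall>u \<in> V. degree E' u \<le> degree_cap"
    "(\<Sum>s \<in> Y. degree E' s) \<le> (\<Sum>s \<in> Y. degree E s) + card (V - Y) * (k - 2)"
    "\<forall>u \<in> V - Y - (V - Y). degree E' u = degree E u"
    "\<forall>v \<in> V - Y. \<exists>T \<subseteq> Y. card T = k - 2 \<and> (\<forall>t \<in> T. {v, t} \<in> E')"
    by (rule attach_vertices[OF VE(1,2) YW degV degN M2 big pos _ _ sum]) (use finV' in auto)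
  have "\<forall>d \<in> [{m..<m + R}]\<^bsup>2\<^esup>. forced E' d"
  proof (rule band_forced)
    fix i j assume "m \<le> i" "i < j" "j \<le> i + k" "j < m + R"
    then have "{i, j} \<in> PS" unfolding PS_def by blast
    then show "forced E' {i, j}" using forced_mono[OF bspec[OF VE(11)] E'(2)] by blast
  qed simp
  then have "\<forall>d \<in> [Y \<union> (V - Y)]\<^bsup>2\<^esup>. forced E' d"
    by (intro forced_complete) (use E'(6) finV' in \<open>auto simp: Y_def\<close>)
  moreover have "Y \<union> (V - Y) = V" using VE(2) by auto
  ultimately show ?thesis using that[OF E'(1)] cardV unfolding R_def by (simp add: algebra_simps)
qed

lemma process_step_attachment:
  assumes att: "attachment V E" and G: "fin_graph G" "verts G = W" "{a, b} \<notin> edges G"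
  shows "process_step H (Graph V (E \<union> edges G)) = Graph V (E \<union> edges (process_step H G))"
proof -
  note A = attachmentD[OF att]
  let ?F = "Graph V (E \<union> edges G)"
  have GW: "edges G \<subseteq> [W]\<^bsup>2\<^esup>" using G by (simp add: fin_graph_def)
  have "[W]\<^bsup>2\<^esup> \<subseteq> [V]\<^bsup>2\<^esup>" using A(2) by (rule nsets_mono)
  then have F: "fin_graph ?F" using A GW by (auto simp: fin_graph_def)
  have bg: "E \<union> edges G \<subseteq> background E" unfolding background_def using GW G(3) by auto
  have "e \<in> edges (process_step H ?F) \<longleftrightarrow> e \<in> E \<union> edges (process_step H G)" for e
  proof
    assume "e \<in> E \<union> edges (process_step H G)"
    moreover have "e \<in> edges (process_step H ?F)" if e: "e \<in> edges (process_step H G)"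
    proof (cases "e \<in> edges G")
      case False
      then obtain f d where f: "e \<in> [W]\<^bsup>2\<^esup>" "f ` verts H \<subseteq> W" "completes H (edges G) e f d"
        using e process_step_iff[OF fin G(1), of e] G(2) by auto
      have "completes H (E \<union> edges G) e f d" using f(3) unfolding completes_def by auto
      moreover have "e \<in> [V]\<^bsup>2\<^esup>" "f ` verts H \<subseteq> V" using f A(2) \<open>[W]\<^bsup>2\<^esup> \<subseteq> [V]\<^bsup>2\<^esup>\<close> by auto
      ultimately show ?thesis using process_step_iff[OF fin F, of e] by auto
    qed (simp add: process_step_def)
    ultimately show "e \<in> edges (process_step H ?F)" by (auto simp: process_step_def)
  next
    assume "e \<in> edges (process_step H ?F)"
    then consider "e \<in> E \<union> edges G" | f d where "completes H (E \<union> edges G) e f d"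
      using process_step_iff[OF fin F, of e] by auto
    then show "e \<in> E \<union> edges (process_step H G)"
    proof cases
      case 1
      then show ?thesis by (auto simp: process_step_def)
    next
      case 2
      then have f: "inj_on f (verts H)" "d \<in> edges H" "f ` d = e" "\<forall>c \<in> edges H - {d}. f ` c \<in> E \<union> edges G"
        by (auto simp: completes_def)
      let ?X = "f ` verts H"
      have sub: "c \<subseteq> verts H" "card c = 2" "finite c" if "c \<in> edges H" for c
        using that EH by (auto simp: nsets_def)
      have cardX: "card ?X = k" using f(1) by (rule card_image)
      have "three_connected_on (background E) ?X"
        unfolding three_connected_on_def connected_on_def
      proof (intro allI impI)
        fix S Y assume S: "S \<subseteq> ?X" "card S \<le> 2" and Y: "Y \<subseteq> ?X - S" "Y \<noteq> {}" "Y \<noteq> ?X - S"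
        define S' where "S' = {x \<in> verts H. f x \<in> S}"
        define Y' where "Y' = {x \<in> verts H. f x \<in> Y}"
        have fS: "f ` S' = S" and fY: "f ` Y' = Y" unfolding S'_def Y'_def using S(1) Y(1) by auto
        have "inj_on f S'" using f(1) by (rule inj_on_subset) (auto simp: S'_def)
        then have "card S' \<le> 2" using card_image[of f S'] fS S(2) by simp
        moreover have "Y' \<subseteq> verts H - S'" unfolding Y'_def S'_def using Y(1) by auto
        moreover have "Y' \<noteq> {}" using Y(2) fY by auto
        moreover have "Y' \<noteq> verts H - S'"
        proof
          assume "Y' = verts H - S'"
          moreover have "?X - S \<subseteq> f ` (verts H - S')" unfolding S'_def by auto
          ultimately show False using fY Y(1,3) by auto
        qed
        moreover have "finite S'" unfolding S'_def using finV by simp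
        ultimately obtain u v where uv: "u \<in> Y'" "v \<in> verts H" "v \<notin> S'" "v \<notin> Y'" "{u, v} \<in> edges H - {d}"
          using three_connected_onD[OF three_connected_minus_edge[OF f(2)], of S' Y'] by metis
        then have "f ` {u, v} \<in> background E" using f(4) bg by blast
        then have "{f u, f v} \<in> background E" by simp
        moreover have "f u \<in> Y" "f v \<in> ?X - S - Y" using uv unfolding Y'_def S'_def by auto
        ultimately show "\<exists>u \<in> Y. \<exists>v \<in> ?X - S - Y. {u, v} \<in> background E" by blast
      qed
      moreover have "h \<le> card (background E \<inter> [?X]\<^bsup>2\<^esup>) + 1"
      proof -
        have "(\<lambda>c. f ` c) ` (edges H - {d}) \<subseteq> background E \<inter> [?X]\<^bsup>2\<^esup>"
          using f(4) bg block_nsets[OF f(1), of "{d}"] by blast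
        moreover have "finite (background E)"
          using background_nsets[OF att] A(1) finite_edges by blast
        ultimately have "card ((\<lambda>c. f ` c) ` (edges H - {d})) \<le> card (background E \<inter> [?X]\<^bsup>2\<^esup>)"
          by (intro card_mono) auto
        moreover have "inj_on (\<lambda>c. f ` c) (edges H - {d})"
        proof (rule inj_onI)
          fix x y assume "x \<in> edges H - {d}" "y \<in> edges H - {d}" "f ` x = f ` y"
          then show "x = y" using sub(1)[of x] sub(1)[of y] inj_on_image_eq_iff[OF f(1)] by blast
        qed
        ultimately show ?thesis using card_image f(2) finE by (fastforce simp: card_Diff_singleton)
      qed
      ultimately have XW: "?X \<subseteq> W" using A(5) cardX unfolding sparse_def by fastforce
      have img: "f ` c \<subseteq> W" if "c \<in> edges H" for c using sub(1)[OF that] XW by auto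
      have "completes H (edges G) e f d" unfolding completes_def
      proof (intro conjI ballI f)
        fix c assume c: "c \<in> edges H - {d}"
        then have "f ` c \<notin> E" using img A(4) by blast
        then show "f ` c \<in> edges G" using f(4) c by blast
      qed
      moreover have "e \<in> [W]\<^bsup>2\<^esup>"
        using img[OF f(2)] f(3) card_image[OF inj_on_subset[OF f(1) sub(1)[OF f(2)]]] sub(2,3)[OF f(2)]
        by (auto simp: nsets_def)
      ultimately show ?thesis using process_step_iff[OF fin G(1), of e] XW G(2) by blast
    qed
  qed
  then have "edges (process_step H ?F) = E \<union> edges (process_step H G)" by blast
  moreover have "verts (process_step H ?F) = V" by (simp add: process_step_def)
  ultimately show ?thesis by (metis graph.exhaust_sel)
qed

lemma process_attachment:
  assumes att: "attachment V E" and G: "fin_graph G" "verts G = W"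
    and ab: "\<And>s. s < t \<Longrightarrow> {a, b} \<notin> edges (H_process H G s)"
  shows "H_process H (Graph V (E \<union> edges G)) t = Graph V (E \<union> edges (H_process H G t))"
  using ab
proof (induction t)
  case 0
  show ?case by simp
next
  case (Suc t)
  have "H_process H (Graph V (E \<union> edges G)) t = Graph V (E \<union> edges (H_process H G t))"
    using Suc.prems by (intro Suc.IH) auto
  then have "H_process H (Graph V (E \<union> edges G)) (Suc t) = process_step H (Graph V (E \<union> edges (H_process H G t)))"
    by simp
  also have "\<dots> = Graph V (E \<union> edges (process_step H (H_process H G t)))"
    using fin_graph_process[OF G(1)] G(2) Suc.prems by (intro process_step_attachment[OF att]) auto
  finally show ?case by simp
qed

end

theorem theorem4p2:
  fixes H :: "'a graph"
  assumes "fin_graph H" and "inseparable_2_1 H"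
  shows "\<exists>C :: real. \<forall>n :: nat. \<exists>G :: nat graph.
           fin_graph G \<and> percolating H G \<and>
           real (card (verts G)) \<le> C * real n \<and>
           running_time H G \<ge> max_running_time H n"
proof -
  interpret inseparable_graph H using assms by unfold_locales
  define c where "c = 1 + (4 * (1 + 2 * degree_cap) ^ k + 1) * (1 + latent_cost)"
  have "\<exists>G :: nat graph. fin_graph G \<and> percolating H G \<and>
          real (card (verts G)) \<le> real c * real n \<and> running_time H G \<ge> max_running_time H n" for n
  proof -
    have "max_running_time H n \<in> {running_time H G | G :: nat graph. fin_graph G \<and> card (verts G) = n}"
      unfolding max_running_time_def using finite_running_times running_times_nonempty by (rule Max_in)
    then obtain G :: "nat graph" where G: "fin_graph G" "card (verts G) = n"
      and rt: "running_time H G = max_running_time H n" by auto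
    show ?thesis
    proof (cases "running_time H G")
      case 0
      let ?K = "complete_graph (verts G)"
      have "fin_graph ?K" using G by (simp add: fin_graph_def complete_graph_def)
      moreover from this have "percolating H ?K"
        by (rule percolatingI) (auto simp: complete_graph_def)
      moreover have "n * 1 \<le> c * n" unfolding c_def by simp
      then have "real n \<le> real c * real n" by (metis mult.right_neutral of_nat_le_iff of_nat_mult)
      ultimately show ?thesis using 0 rt G(2) by (intro exI[of _ ?K]) (simp add: complete_graph_def)
    next
      case (Suc t)
      have "H_process H G t \<noteq> H_process H G (Suc t)" using Suc by (intro running_time_not_stable) simp
      then have "edges (H_process H G t) \<noteq> edges (H_process H G (Suc t))"
        by (metis graph.expand verts_process)
      then obtain e where e: "e \<in> edges (H_process H G (Suc t))" "e \<notin> edges (H_process H G t)"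
        using process_edges_mono[of H G t 1] by auto
      have "edges (H_process H G (Suc t)) \<subseteq> [verts G]\<^bsup>2\<^esup>"
        using fin_graph_process[OF G(1), of H "Suc t"] unfolding fin_graph_def verts_process by simp
      then obtain a b where eab: "e = {a, b}" "a \<in> verts G" "b \<in> verts G" "a \<noteq> b"
        using nsets2_memE[OF e(1)] by metis
      have finG: "finite (verts G)" using G by (simp add: fin_graph_def)
      interpret triggered_graph H "verts G" a b using eab finG by unfold_locales auto
      obtain V E where VE: "attachment V E" "\<forall>d \<in> [V]\<^bsup>2\<^esup>. forced E d"
        "card V \<le> card (verts G) + clique_size (card (verts G)) * (1 + latent_cost)"
        by (rule percolating_attachment)
      define F where "F = Graph V (E \<union> edges G)"
      note A = attachmentD[OF VE(1)]
      have "edges G \<subseteq> [V]\<^bsup>2\<^esup>" using G(1) nsets_mono[OF A(2), of 2] by (auto simp: fin_graph_def)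
      then have F: "fin_graph F" unfolding F_def fin_graph_def using A by simp
      have before: "{a, b} \<notin> edges (H_process H G s)" if "s < Suc t" for s
        using process_edges_mono[of H G s "t - s"] e(2) that eab(1) by auto
      have Ft: "H_process H F t = Graph V (E \<union> edges (H_process H G t))"
        unfolding F_def using before by (intro process_attachment[OF VE(1) G(1)]) auto
      have FSt: "H_process H F (Suc t) = Graph V (E \<union> edges (H_process H G (Suc t)))"
        unfolding F_def by (rule process_attachment[OF VE(1) G(1) refl before])
      have "{a, b} \<notin> E" using A(4)[of "{a, b}"] eab by auto
      then have "{a, b} \<notin> edges (H_process H F t)" using e(2) eab(1) unfolding Ft by simp
      moreover have abF: "{a, b} \<in> edges (H_process H F (Suc t))" using e(1) eab(1) unfolding FSt by simp
      ultimately have "H_process H F t \<noteq> H_process H F (Suc t)" by metis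
      then have "Suc t \<le> running_time H F" using F by (intro running_time_ge)
      moreover have "percolating H F"
      proof (rule percolatingI[OF F])
        fix Z d assume Z: "percolation_closed H Z" "edges F \<subseteq> Z" and d: "d \<in> [verts F]\<^bsup>2\<^esup>"
        have closed: "edges (H_process H F s) \<subseteq> Z" for s
        proof (induction s)
          case 0
          show ?case using Z(2) by simp
        next
          case (Suc s)
          show ?case
          proof
            fix x assume "x \<in> edges (H_process H F (Suc s))"
            then consider "x \<in> edges (H_process H F s)"
              | f h where "completes H (edges (H_process H F s)) x f h"
              using process_step_iff[OF fin fin_graph_process[OF F, of H s], of x] by auto
            then show "x \<in> Z"
            proof cases
              case 1
              then show ?thesis using Suc.IH by blast
            next
              case 2
              then have "completes H Z x f h" using Suc.IH unfolding completes_def by blast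
              then show ?thesis using Z(1) unfolding percolation_closed_def by blast
            qed
          qed
        qed
        have "insert {a, b} E \<subseteq> Z" using closed[of "Suc t"] abF Z(2) unfolding F_def by auto
        moreover have "forced E d" using VE(2) d unfolding F_def by simp
        ultimately show "d \<in> Z" using Z(1) unfolding forced_def by blast
      qed
      moreover have "card V \<le> c * n"
      proof -
        have n: "1 \<le> n" using G(2) finG eab(2) by (auto simp: Suc_le_eq card_gt_0_iff)
        have "clique_size n \<le> (4 * (1 + 2 * degree_cap) ^ k + 1) * n"
        proof -
          have "2 * (n + 1) * (1 + 2 * degree_cap) ^ k \<le> 4 * n * (1 + 2 * degree_cap) ^ k"
            using n by (intro mult_right_mono) auto
          moreover have "(4 * (1 + 2 * degree_cap) ^ k + 1) * n = 4 * n * (1 + 2 * degree_cap) ^ k + n"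
            by (simp add: algebra_simps)
          ultimately show ?thesis unfolding clique_size_def using n by linarith
        qed
        then have "clique_size n * (1 + latent_cost) \<le> (4 * (1 + 2 * degree_cap) ^ k + 1) * n * (1 + latent_cost)"
          by (rule mult_right_mono) simp
        then show ?thesis using VE(3) G(2) unfolding c_def by (simp add: algebra_simps)
      qed
      then have "real (card V) \<le> real c * real n" by (metis of_nat_le_iff of_nat_mult)
      ultimately show ?thesis using F rt Suc unfolding F_def by (intro exI[of _ F]) (simp add: F_def)
    qed
  qed
  then show ?thesis by blast
qed

end
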